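(* Bloxorz with a $1\times1\times1$ cube on levels with switches and trapdoors (defined below) can be solved in polynomial time. Moreover, on a level with $n$ tiles, whenever a solution exists there is one using $O(n^2)$ moves, and there are levels for which every solution requires $\Omega(n^2)$ moves (i.e., $\Theta(n^2)$ moves are needed in the worst case).
   Context: The game is played on the integer grid $\mathbb{Z}^2$ with a $1\times1\times1$ cube occupying a single cell; a move takes the cube to one of the four edge-adjacent cells. A level is a finite set of grid cells (tiles), each a normal tile, a trapdoor, or a switch, together with a one-to-one correspondence between trapdoors and switches, an initial state (open or closed) for each trapdoor, a start square and a goal square. The cube starts on the start square. When a move places the cube on a switch, the state of the corresponding trapdoor is toggled (open $\leftrightarrow$ closed); this is applied first, and then the move is legal only if the cell occupied by the cube is a tile of the level that is not an open trapdoor. The question is whether there is a sequence of legal moves taking the cube from the start square to the goal square. The size $n$ of a level is its number of tiles. *)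

theory Defs
  imports Complex_Main "HOL-Computational_Algebra.Polynomial"
begin

section \<open>The game\<close>

type_synonym cell = "int \<times> int"

datatype tile_kind = Normal | Trapdoor | Switch

text \<open>
  The component \<open>partner\<close> sends a switch to the trapdoor it controls; its values
  on cells that are not switches are never used.
\<close>

record level =
  tile_at :: "cell \<Rightarrow> tile_kind option"
  partner :: "cell \<Rightarrow> cell"
  initially_open :: "cell set"
  start :: cell
  goal :: cell

definition tiles :: "level \<Rightarrow> cell set" where
  "tiles L = dom (tile_at L)"

definition tiles_of_kind :: "level \<Rightarrow> tile_kind \<Rightarrow> cell set" where
  "tiles_of_kind L k = {c. tile_at L c = Some k}"

abbreviation trapdoors :: "level \<Rightarrow> cell set" where
  "trapdoors L \<equiv> tiles_of_kind L Trapdoor"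

abbreviation switches :: "level \<Rightarrow> cell set" where
  "switches L \<equiv> tiles_of_kind L Switch"

definition valid_level :: "level \<Rightarrow> bool" where
  "valid_level L \<longleftrightarrow>
     finite (tiles L) \<and>
     bij_betw (partner L) (switches L) (trapdoors L) \<and>
     initially_open L \<subseteq> trapdoors L \<and>
     start L \<in> tiles L \<and> goal L \<in> tiles L"

definition num_tiles :: "level \<Rightarrow> nat" where
  "num_tiles L = card (tiles L)"

datatype direction = East | North | West | South

fun neighbour :: "direction \<Rightarrow> cell \<Rightarrow> cell" where
  "neighbour East (x, y) = (x + 1, y)"
| "neighbour North (x, y) = (x, y + 1)"
| "neighbour West (x, y) = (x - 1, y)"
| "neighbour South (x, y) = (x, y - 1)"

text \<open>A configuration is the cell occupied by the cube and the set of open trapdoors.\<close>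

type_synonym configuration = "cell \<times> cell set"

definition toggle :: "'a \<Rightarrow> 'a set \<Rightarrow> 'a set" where
  "toggle t X = (if t \<in> X then X - {t} else insert t X)"

definition land_on :: "level \<Rightarrow> cell \<Rightarrow> cell set \<Rightarrow> cell set" where
  "land_on L c X = (if c \<in> switches L then toggle (partner L c) X else X)"

text \<open>The result is \<open>None\<close> if the move is illegal; legality is judged after the toggling.\<close>

fun make_move :: "level \<Rightarrow> direction \<Rightarrow> configuration \<Rightarrow> configuration option" where
  "make_move L d (c, X) =
     (let c' = neighbour d c; X' = land_on L c' X
      in if c' \<in> tiles L \<and> c' \<notin> X' then Some (c', X') else None)"

fun make_moves :: "level \<Rightarrow> direction list \<Rightarrow> configuration \<Rightarrow> configuration option" where
  "make_moves L [] s = Some s"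
| "make_moves L (d # ds) s = Option.bind (make_move L d s) (make_moves L ds)"

definition solution :: "level \<Rightarrow> direction list \<Rightarrow> bool" where
  "solution L ds \<longleftrightarrow>
     (\<exists>X. make_moves L ds (start L, initially_open L) = Some (goal L, X))"

definition solvable :: "level \<Rightarrow> bool" where
  "solvable L \<longleftrightarrow> (\<exists>ds. solution L ds)"

section \<open>Polynomial time\<close>

text \<open>
  The machine model is Jones's language WHILE: structured programs whose variables hold
  binary trees.  A tree operation or a test of a tree for being \<open>Leaf\<close> costs one unit.
  Each such step is a constant number of pointer operations on a heap of immutable,
  shared nodes, of which at most one is allocated per step, and conversely a Turing
  machine tape is simulated by two lists with constant overhead per step.  Polynomial
  time in this model is therefore polynomial time on Turing machines.
\<close>

datatype tree = Leaf | Node tree tree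

fun left :: "tree \<Rightarrow> tree" where
  "left Leaf = Leaf"
| "left (Node l r) = l"

fun right :: "tree \<Rightarrow> tree" where
  "right Leaf = Leaf"
| "right (Node l r) = r"

datatype expr = Var nat | LeafE | NodeE expr expr | LeftE expr | RightE expr

type_synonym store = "nat \<Rightarrow> tree"

fun expr_val :: "expr \<Rightarrow> store \<Rightarrow> tree" where
  "expr_val (Var x) s = s x"
| "expr_val LeafE s = Leaf"
| "expr_val (NodeE a b) s = Node (expr_val a s) (expr_val b s)"
| "expr_val (LeftE a) s = left (expr_val a s)"
| "expr_val (RightE a) s = right (expr_val a s)"

fun expr_cost :: "expr \<Rightarrow> nat" where
  "expr_cost (Var x) = 1"
| "expr_cost LeafE = 1"
| "expr_cost (NodeE a b) = 1 + expr_cost a + expr_cost b"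
| "expr_cost (LeftE a) = 1 + expr_cost a"
| "expr_cost (RightE a) = 1 + expr_cost a"

datatype program =
    SKIP
  | ASSIGN nat expr
  | SEQ program program
  | IF expr program program
  | WHILE expr program

text \<open>
  \<open>exec p s t s'\<close>: started in store \<open>s\<close>, program \<open>p\<close> halts in store \<open>s'\<close> after \<open>t\<close> units of
  time.  A condition holds iff its value is not \<open>Leaf\<close>.
\<close>

inductive exec :: "program \<Rightarrow> store \<Rightarrow> nat \<Rightarrow> store \<Rightarrow> bool" where
  Skip: "exec SKIP s 1 s"
| Assign: "exec (ASSIGN x a) s (1 + expr_cost a) (s(x := expr_val a s))"
| Seq: "exec p s t s' \<Longrightarrow> exec q s' u s'' \<Longrightarrow> exec (SEQ p q) s (1 + t + u) s''"
| IfTrue: "expr_val b s \<noteq> Leaf \<Longrightarrow> exec p s t s' \<Longrightarrow>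
    exec (IF b p q) s (1 + expr_cost b + t) s'"
| IfFalse: "expr_val b s = Leaf \<Longrightarrow> exec q s t s' \<Longrightarrow>
    exec (IF b p q) s (1 + expr_cost b + t) s'"
| WhileTrue: "expr_val b s \<noteq> Leaf \<Longrightarrow> exec p s t s' \<Longrightarrow> exec (WHILE b p) s' u s'' \<Longrightarrow>
    exec (WHILE b p) s (1 + expr_cost b + t + u) s''"
| WhileFalse: "expr_val b s = Leaf \<Longrightarrow> exec (WHILE b p) s (1 + expr_cost b) s"

inductive_cases SkipE: "exec SKIP s t s'"
inductive_cases AssignE: "exec (ASSIGN x a) s t s'"
inductive_cases SeqE: "exec (SEQ p q) s t s'"
inductive_cases IfE: "exec (IF b p q) s t s'"
inductive_cases WhileE: "exec (WHILE b p) s t s'"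

lemma exec_deterministic:
  "exec p s t s' \<Longrightarrow> exec p s u s'' \<Longrightarrow> u = t \<and> s'' = s'"
proof (induction arbitrary: u s'' rule: exec.induct)
  case (Skip s)
  then show ?case by (rule SkipE) simp
next
  case (Assign x a s)
  then show ?case by (rule AssignE) simp
next
  case (Seq p s t s' q v s3)
  from Seq.prems show ?case by (rule SeqE) (metis Seq.IH plus_1_eq_Suc add_Suc)
next
  case (IfTrue b s p t s' q)
  from IfTrue.prems show ?case by (rule IfE) (metis IfTrue.hyps(1) IfTrue.IH plus_1_eq_Suc add_Suc)+
next
  case (IfFalse b s q t s' p)
  from IfFalse.prems show ?case by (rule IfE) (metis IfFalse.hyps(1) IfFalse.IH plus_1_eq_Suc add_Suc)+
next
  case (WhileTrue b s p t s' v s3)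
  from WhileTrue.prems show ?case
    by (rule WhileE) (metis WhileTrue.hyps(1) WhileTrue.IH plus_1_eq_Suc add_Suc)+
next
  case (WhileFalse b s p)
  from WhileFalse.prems show ?case by (rule WhileE) (metis WhileFalse.hyps plus_1_eq_Suc add_Suc)+
qed

text \<open>
  Input and output are both in variable 0 and all other variables are initially \<open>Leaf\<close>;
  the input is accepted iff the output is not \<open>Leaf\<close>.  The relation \<open>enc x d\<close> says that
  the tree \<open>d\<close> encodes the instance \<open>x\<close>.  The size of an input is its number of inner nodes.
\<close>

definition input_store :: "tree \<Rightarrow> store" where
  "input_store d = (\<lambda>x. if x = 0 then d else Leaf)"

definition decidable_in_polynomial_time ::
    "('a \<Rightarrow> tree \<Rightarrow> bool) \<Rightarrow> 'a set \<Rightarrow> ('a \<Rightarrow> bool) \<Rightarrow> bool" where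
  "decidable_in_polynomial_time enc instances P \<longleftrightarrow>
     (\<exists>p :: program. \<exists>q :: nat poly. \<forall>x \<in> instances. \<forall>d. enc x d \<longrightarrow>
        (\<exists>t s. exec p (input_store d) t s \<and> t \<le> poly q (size d) \<and>
               (s 0 \<noteq> Leaf \<longleftrightarrow> P x)))"

section \<open>Encoding levels as trees\<close>

fun enc_list :: "tree list \<Rightarrow> tree" where
  "enc_list [] = Leaf"
| "enc_list (d # ds) = Node d (enc_list ds)"

definition enc_bool :: "bool \<Rightarrow> tree" where
  "enc_bool b = (if b then Node Leaf Leaf else Leaf)"

text \<open>Binary digits, least significant first, without leading zeros.\<close>

fun binary_digits :: "nat \<Rightarrow> bool list" where
  "binary_digits n = (if n = 0 then [] else odd n # binary_digits (n div 2))"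

declare binary_digits.simps [simp del]

definition enc_int :: "int \<Rightarrow> tree" where
  "enc_int i = Node (enc_bool (i < 0)) (enc_list (map enc_bool (binary_digits (nat \<bar>i\<bar>))))"

definition enc_cell :: "cell \<Rightarrow> tree" where
  "enc_cell c = Node (enc_int (fst c)) (enc_int (snd c))"

definition enc_tile :: "level \<Rightarrow> cell \<Rightarrow> tree" where
  "enc_tile L c = Node (enc_cell c)
     (case the (tile_at L c) of
        Normal \<Rightarrow> Leaf
      | Trapdoor \<Rightarrow> Node Leaf (enc_bool (c \<in> initially_open L))
      | Switch \<Rightarrow> Node (Node Leaf Leaf) (enc_cell (partner L c)))"

text \<open>The tiles may be listed in any order.\<close>

definition encodes_level :: "level \<Rightarrow> tree \<Rightarrow> bool" where
  "encodes_level L d \<longleftrightarrow>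
     (\<exists>cs. distinct cs \<and> set cs = tiles L \<and>
           d = enc_list [enc_cell (start L), enc_cell (goal L), enc_list (map (enc_tile L) cs)])"

end

theory Submission
  imports Defs
begin

text \<open>
  Suppose the cube is on a cell \<open>h\<close> that is neither a switch nor an open trapdoor.  It can walk
  along any simple path avoiding open trapdoors, with at most seven moves per cell, because a
  switch on the way can be landed on twice.  If it thus gets to a switch whose trapdoor is open,
  the reversed walk takes it back to \<open>h\<close> and restores everything but this trapdoor, which is now
  closed.  Hence trapdoors can be closed one at a time, with \<open>O(n)\<close> moves each, and the reachable
  cells are those found by a naive closure that treats a trapdoor as passable once its switch has
  been found.  This gives both the quadratic bound and the polynomial algorithm.  After the first
  move the cube is not on an open trapdoor; if it is on a switch and has a further move, it can
  leave the adjacent switches for some \<open>h\<close> as above without affecting the closure.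

  For the lower bound, trapdoors and their switches are placed at the two ends of a corridor so
  that each switch is behind the preceding trapdoor at the opposite end of the next one.
\<close>

section \<open>Paths and sequences of moves\<close>

text \<open>Reversing a walk repeats its landings backwards, except that the landing on the last
  cell is dropped and one on the first cell is added. Hence home cells must not be switches, and the
  way back after closing a trapdoor is the reverse of a walk planned with that trapdoor already
  closed, not of the walk just made. Passing a switch without effect is a matter of parity: two
  landings on it need a neighbouring cell in between, and that cell may itself be a switch or be the
  trapdoor that the first landing has just opened. The factor seven is the worst case, where the
  cell behind is this trapdoor and the cell ahead is another switch. Fewer open trapdoors never
  shrink the explored set, so the number of open ones is a suitable induction measure. No program
  for the game is written down as a whole. The functions computable in polynomial time are closed
  under composition, folds and iteration with polynomially bounded intermediate values, and the
  decision procedure is assembled from these.\<close>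

definition adjacent :: "cell \<Rightarrow> cell \<Rightarrow> bool" where
  "adjacent c c' \<longleftrightarrow> (\<exists>d. c' = neighbour d c)"

lemma adjacent_iff:
  "adjacent (x, y) (x', y') \<longleftrightarrow>
     x = x' \<and> (y' = y + 1 \<or> y = y' + 1) \<or> y = y' \<and> (x' = x + 1 \<or> x = x' + 1)"
proof
  assume "adjacent (x, y) (x', y')"
  then obtain d where "(x', y') = neighbour d (x, y)" by (auto simp: adjacent_def)
  then show "x = x' \<and> (y' = y + 1 \<or> y = y' + 1) \<or> y = y' \<and> (x' = x + 1 \<or> x = x' + 1)"
    by (cases d) auto
next
  assume "x = x' \<and> (y' = y + 1 \<or> y = y' + 1) \<or> y = y' \<and> (x' = x + 1 \<or> x = x' + 1)"
  then have "(x', y') \<in> {neighbour East (x, y), neighbour North (x, y),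
    neighbour West (x, y), neighbour South (x, y)}" by auto
  then show "adjacent (x, y) (x', y')" unfolding adjacent_def by blast
qed

lemma adjacent_sym: "adjacent c c' \<Longrightarrow> adjacent c' c"
  by (cases c; cases c') (auto simp: adjacent_iff)

definition path :: "cell set \<Rightarrow> (nat \<Rightarrow> cell) \<Rightarrow> nat \<Rightarrow> bool" where
  "path A p k \<longleftrightarrow> (\<forall>i\<le>k. p i \<in> A) \<and> (\<forall>i<k. adjacent (p i) (p (Suc i)))"

definition connected_in :: "cell set \<Rightarrow> cell \<Rightarrow> cell \<Rightarrow> bool" where
  "connected_in A x y \<longleftrightarrow> (\<exists>p k. path A p k \<and> p 0 = x \<and> p k = y)"

lemma connected_in_refl: "x \<in> A \<Longrightarrow> connected_in A x x"
  unfolding connected_in_def path_def by (intro exI[of _ "\<lambda>_. x"] exI[of _ 0]) auto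

lemma connected_in_step:
  assumes "connected_in A x y" "adjacent y z" "z \<in> A"
  shows "connected_in A x z"
proof -
  obtain p k where p: "path A p k" "p 0 = x" "p k = y"
    using assms(1) unfolding connected_in_def by blast
  have "path A (p(Suc k := z)) (Suc k)"
    using p assms unfolding path_def by (auto simp: less_Suc_eq le_Suc_eq)
  then show ?thesis
    unfolding connected_in_def using p by (intro exI[of _ "p(Suc k := z)"] exI[of _ "Suc k"]) auto
qed

lemma connected_in_members:
  "connected_in A x y \<Longrightarrow> x \<in> A" "connected_in A x y \<Longrightarrow> y \<in> A"
  unfolding connected_in_def path_def by auto

text \<open>Paths are indexed sequences because walks along them refer to neighbouring positions;
  this rule recovers induction over single steps.\<close>

lemma connected_in_induct [consumes 1, case_names base step]:
  assumes "connected_in A x y" "P x"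
    and "\<And>y z. connected_in A x y \<Longrightarrow> P y \<Longrightarrow> adjacent y z \<Longrightarrow> z \<in> A \<Longrightarrow> P z"
  shows "P y"
proof -
  obtain p k where p: "path A p k" "p 0 = x" "p k = y"
    using assms(1) unfolding connected_in_def by blast
  have "i \<le> k \<Longrightarrow> connected_in A x (p i) \<and> P (p i)" for i
  proof (induction i)
    case 0
    then show ?case using p assms(2) by (auto intro: connected_in_refl simp: path_def)
  next
    case (Suc i)
    then show ?case using p assms(3) connected_in_step
      unfolding path_def by (metis Suc_leD Suc_le_lessD)
  qed
  then show ?thesis using p by auto
qed

lemma connected_in_trans:
  assumes "connected_in A x y" "connected_in A y z"
  shows "connected_in A x z"
  using assms(2) by (induction rule: connected_in_induct) (use assms(1) connected_in_step in blast)+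

lemma connected_in_sym:
  assumes "connected_in A x y"
  shows "connected_in A y x"
  using assms
proof (induction rule: connected_in_induct)
  case base
  show ?case using connected_in_members(1)[OF assms] by (rule connected_in_refl)
next
  case (step y z)
  then have "connected_in A z y"
    using connected_in_step[OF connected_in_refl adjacent_sym] connected_in_members(2) by blast
  then show ?case using step.IH by (rule connected_in_trans)
qed

text \<open>A shortest path is simple: a repeated cell would allow cutting out the part between its
  two occurrences.\<close>

lemma simple_path:
  assumes "connected_in A x y"
  obtains p k where "path A p k" "p 0 = x" "p k = y" "inj_on p {..k}"
proof -
  define Q where "Q k \<longleftrightarrow> (\<exists>p. path A p k \<and> p 0 = x \<and> p k = y)" for k
  have ex: "\<exists>k. Q k" using assms unfolding Q_def connected_in_def by blast
  define k where "k = (LEAST k. Q k)"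
  have "Q k" unfolding k_def using ex by (rule LeastI_ex)
  then obtain p where p: "path A p k" "p 0 = x" "p k = y" unfolding Q_def by blast
  have False if ij: "i < j" "j \<le> k" "p i = p j" for i j
  proof -
    define p' where "p' l = (if l \<le> i then p l else p (l + (j - i)))" for l
    have adj: "adjacent (p l) (p (Suc l))" if "l < k" for l using p that by (auto simp: path_def)
    have "adjacent (p' l) (p' (Suc l))" if l: "l < k - (j - i)" for l
    proof -
      consider "l < i" | "l = i" | "l > i" by linarith
      then show ?thesis
      proof cases
        case 1
        then show ?thesis using adj[of l] ij by (simp add: p'_def)
      next
        case 2
        then show ?thesis using adj[of j] ij l by (simp add: p'_def)
      next
        case 3
        then show ?thesis using adj[of "l + (j - i)"] ij l by (simp add: p'_def)
      qed
    qed
    moreover have "p' l \<in> A" if "l \<le> k - (j - i)" for l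
      using p that ij by (auto simp: p'_def path_def)
    moreover have "p' 0 = x" using p by (simp add: p'_def)
    moreover have "p' (k - (j - i)) = y"
    proof (cases "j = k")
      case True
      then show ?thesis using p ij by (simp add: p'_def)
    next
      case False
      then have "\<not> k - (j - i) \<le> i" "k - (j - i) + (j - i) = k" using ij by auto
      then show ?thesis using p by (simp add: p'_def)
    qed
    ultimately have "Q (k - (j - i))" unfolding Q_def path_def by blast
    then have "k \<le> k - (j - i)" unfolding k_def by (rule Least_le)
    then show False using ij by linarith
  qed
  then have "inj_on p {..k}"
    by (intro inj_onI) (metis atMost_iff linorder_neqE_nat)
  then show ?thesis using p that by blast
qed

lemma simple_path_length:
  assumes "path A p k" "inj_on p {..k}" "finite A"
  shows "k < card A"
proof -
  have "card (p ` {..k}) \<le> card A"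
    using assms by (intro card_mono) (auto simp: path_def)
  then show ?thesis using assms(2) by (simp add: card_image)
qed

section \<open>Toggling and move sequences of bounded length\<close>

lemma toggle_iff [simp]: "x \<in> toggle t X \<longleftrightarrow> (x \<in> X) \<noteq> (x = t)"
  by (auto simp: toggle_def)

lemma toggle_toggle [simp]: "toggle t (toggle t X) = X"
  by auto

lemma toggle_commute: "toggle t (toggle u X) = toggle u (toggle t X)"
  by auto

definition reaches :: "level \<Rightarrow> nat \<Rightarrow> configuration \<Rightarrow> configuration \<Rightarrow> bool" where
  "reaches L k s s' \<longleftrightarrow> (\<exists>ds. length ds \<le> k \<and> make_moves L ds s = Some s')"

lemma make_moves_append:
  "make_moves L (ds @ es) s = Option.bind (make_moves L ds s) (make_moves L es)"
  by (induction ds arbitrary: s) (auto split: Option.bind_split)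

lemma reaches_refl [simp]: "reaches L k s s"
  unfolding reaches_def by (intro exI[of _ "[]"]) auto

lemma reaches_trans: "reaches L k s s' \<Longrightarrow> reaches L l s' s'' \<Longrightarrow> reaches L (k + l) s s''"
  unfolding reaches_def by (metis (no_types, lifting) add_mono bind.bind_lunit length_append make_moves_append)

lemma reaches_mono: "reaches L k s s' \<Longrightarrow> k \<le> l \<Longrightarrow> reaches L l s s'"
  unfolding reaches_def using le_trans by blast

lemma make_move_iff:
  "(\<exists>d. make_move L d (c, X) = Some (c', X')) \<longleftrightarrow>
     adjacent c c' \<and> c' \<in> tiles L \<and> X' = land_on L c' X \<and> c' \<notin> X'"
  by (auto simp: adjacent_def Let_def split: if_splits)

lemma reaches_one:
  assumes "adjacent c c'" "c' \<in> tiles L" "c' \<notin> land_on L c' X"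
  shows "reaches L 1 (c, X) (c', land_on L c' X)"
proof -
  obtain d where "make_move L d (c, X) = Some (c', land_on L c' X)"
    using make_move_iff assms by blast
  then show ?thesis unfolding reaches_def by (intro exI[of _ "[d]"]) auto
qed

lemma reaches_snoc:
  assumes "reaches L k s (c, X)" "adjacent c c'" "c' \<in> tiles L" "X' = land_on L c' X" "c' \<notin> X'"
  shows "reaches L (Suc k) s (c', X')"
  using reaches_trans[OF assms(1) reaches_one] assms by simp

text \<open>Peels off the last move, so that properties of configurations are carried forward from
  the start; the counter allows them to bound the number of moves.\<close>

lemma make_moves_induct [consumes 1, case_names Nil Snoc]:
  assumes "make_moves L ds s = Some (c, X)"
    and "\<And>c X. s = (c, X) \<Longrightarrow> P 0 c X"
    and "\<And>n c X c' X'. P n c X \<Longrightarrow> adjacent c c' \<Longrightarrow> c' \<in> tiles L \<Longrightarrow> X' = land_on L c' X \<Longrightarrow>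
       c' \<notin> X' \<Longrightarrow> P (Suc n) c' X'"
  shows "P (length ds) c X"
  using assms(1)
proof (induction ds arbitrary: c X rule: rev_induct)
  case Nil
  then show ?case using assms(2) by auto
next
  case (snoc d ds)
  then obtain c1 X1 where 1: "make_moves L ds s = Some (c1, X1)" "make_move L d (c1, X1) = Some (c, X)"
    by (auto simp: make_moves_append split: Option.bind_splits)
  then have "adjacent c1 c \<and> c \<in> tiles L \<and> X = land_on L c X1 \<and> c \<notin> X"
    using make_move_iff by blast
  with assms(3)[OF snoc.IH[OF 1(1)], of c X] show ?case unfolding length_append_singleton by blast
qed

section \<open>Reachability\<close>

text \<open>Neither the position of the cube nor any later trapdoor state is tracked: a switch
  unlocks its trapdoor for good, wherever in the explored set it lies. This makes the set computable
  by a simple iteration.\<close>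

inductive_set explored :: "level \<Rightarrow> cell set \<Rightarrow> cell \<Rightarrow> cell set" for L X q where
  base: "q \<in> explored L X q"
| not_open: "c \<in> explored L X q \<Longrightarrow> adjacent c c' \<Longrightarrow> c' \<in> tiles L \<Longrightarrow> c' \<notin> X \<Longrightarrow>
    c' \<in> explored L X q"
| unlocked: "c \<in> explored L X q \<Longrightarrow> adjacent c c' \<Longrightarrow> c' \<in> tiles L \<Longrightarrow>
    s \<in> explored L X q \<Longrightarrow> s \<in> switches L \<Longrightarrow> partner L s = c' \<Longrightarrow> c' \<in> explored L X q"

locale valid_game =
  fixes L :: level
  assumes valid: "valid_level L"
begin

lemma finite_tiles: "finite (tiles L)"
  using valid by (simp add: valid_level_def)

lemma switch_tile: "s \<in> switches L \<Longrightarrow> s \<in> tiles L"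
  by (auto simp: tiles_of_kind_def tiles_def)

lemma trapdoor_tile: "trapdoors L \<subseteq> tiles L"
  by (auto simp: tiles_of_kind_def tiles_def)

lemma finite_open: "X \<subseteq> trapdoors L \<Longrightarrow> finite X"
  by (meson finite_subset finite_tiles trapdoor_tile)

lemma card_open: "X \<subseteq> trapdoors L \<Longrightarrow> card X \<le> num_tiles L"
  unfolding num_tiles_def by (meson card_mono finite_tiles order_trans trapdoor_tile)

lemma card_switches: "card (switches L) \<le> num_tiles L"
  unfolding num_tiles_def using switch_tile finite_tiles by (meson card_mono subsetI)

lemma finite_switches: "finite (switches L)"
  using switch_tile finite_tiles by (meson finite_subset subsetI)

lemma switch_not_trapdoor: "s \<in> switches L \<Longrightarrow> s \<notin> trapdoors L"
  by (auto simp: tiles_of_kind_def)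

lemma partner_trapdoor: "s \<in> switches L \<Longrightarrow> partner L s \<in> trapdoors L"
  using valid by (auto simp: valid_level_def bij_betw_def)

lemma partner_eq_iff:
  "s \<in> switches L \<Longrightarrow> s' \<in> switches L \<Longrightarrow> partner L s = partner L s' \<longleftrightarrow> s = s'"
  using valid by (auto simp: valid_level_def bij_betw_def inj_on_def)

lemma land_on_switch [simp]: "c \<in> switches L \<Longrightarrow> land_on L c X = toggle (partner L c) X"
  by (simp add: land_on_def)

lemma land_on_other [simp]: "c \<notin> switches L \<Longrightarrow> land_on L c X = X"
  by (simp add: land_on_def)

lemma land_on_land_on [simp]: "land_on L c (land_on L c X) = X"
  by (simp add: land_on_def)

lemma land_on_trapdoors: "X \<subseteq> trapdoors L \<Longrightarrow> land_on L c X \<subseteq> trapdoors L"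
  using partner_trapdoor[of c] by (auto simp: land_on_def toggle_def)

text \<open>A switch is never its own trapdoor, so the legality of a landing can be read off the
  state before the toggling.\<close>

lemma in_land_on_iff [simp]: "c \<in> land_on L c X \<longleftrightarrow> c \<in> X"
  using partner_trapdoor[of c] switch_not_trapdoor[of c] by (auto simp: land_on_def)

lemma reaches_switch:
  assumes "reaches L k s (c, X)" "adjacent c c'" "c' \<in> switches L" "X \<subseteq> trapdoors L"
  shows "reaches L (Suc k) s (c', toggle (partner L c') X)"
  using assms switch_not_trapdoor[OF assms(3)] partner_trapdoor[OF assms(3)]
  by (intro reaches_snoc[OF assms(1,2)] switch_tile) auto

lemma reaches_other:
  assumes "reaches L k s (c, X)" "adjacent c c'" "c' \<notin> switches L" "c' \<in> tiles L" "c' \<notin> X"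
  shows "reaches L (Suc k) s (c', X)"
  using assms by (intro reaches_snoc[OF assms(1,2)]) auto

text \<open>Each toggling is an involution. The reversed walk starts in the state before the last
  landing and ends with an extra landing on \<open>c\<close>, hence \<open>land_on\<close> at both
  ends; \<open>c \<notin> X\<close> makes that landing legal.\<close>

lemma reaches_reverse:
  assumes "reaches L k (c, X) (c', X')" "c \<in> tiles L" "c \<notin> X"
  shows "reaches L k (c', land_on L c' X') (c, land_on L c X)"
proof -
  obtain ds where ds: "length ds \<le> k" "make_moves L ds (c, X) = Some (c', X')"
    using assms unfolding reaches_def by blast
  from ds(2) have "c' \<in> tiles L \<and> c' \<notin> X' \<and>
    reaches L (length ds) (c', land_on L c' X') (c, land_on L c X)"
  proof (induction rule: make_moves_induct)
    case (Nil c' X')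
    then show ?case using assms by auto
  next
    case (Snoc n c1 X1 c2 X2)
    then have "reaches L 1 (c2, X1) (c1, land_on L c1 X1)"
      by (intro reaches_one adjacent_sym[of c1 c2]) auto
    from reaches_trans[OF this] Snoc show ?case by auto
  qed
  then show ?thesis using ds(1) reaches_mono by blast
qed

text \<open>
  A switch entered from a non-switch is landed on twice, bouncing back where possible and
  otherwise going ahead; two consecutive switches \<open>a\<close>, \<open>b\<close> are landed on as \<open>a b a b\<close>.
  Along a simple path one can thus be on any cell but the last with no trapdoor changed.
\<close>

lemma clean_walk:
  assumes Y: "Y \<subseteq> trapdoors L"
    and p: "path (tiles L - Y) p k" "inj_on p {..k}" "p 0 \<notin> switches L"
  shows "i < k \<Longrightarrow> reaches L (7 * i) (p 0, Y) (p i, Y)"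
proof (induction i rule: less_induct)
  case (less i)
  have adj: "adjacent (p j) (p (Suc j))" "adjacent (p (Suc j)) (p j)" if "j < k" for j
    using p(1) that adjacent_sym by (auto simp: path_def)
  have mem: "p j \<in> tiles L" "p j \<notin> Y" if "j \<le> k" for j
    using p(1) that by (auto simp: path_def)
  have neq: "p j \<noteq> p (Suc (Suc j))" if "Suc (Suc j) \<le> k" for j
    using p(2) that by (auto dest!: inj_onD[of p "{..k}" j "Suc (Suc j)"])
  have tog: "toggle t X \<subseteq> trapdoors L" if "t \<in> trapdoors L" "X \<subseteq> trapdoors L" for t X
    using that by (auto simp: toggle_def)
  show ?case
  proof (cases i)
    case 0
    then show ?thesis by simp
  next
    case (Suc j)
    let ?x = "p j" and ?s = "p (Suc j)"
    have j: "reaches L (7 * j) (p 0, Y) (?x, Y)" using less Suc by simp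
    show ?thesis
    proof (cases "?s \<in> switches L")
      case False
      then show ?thesis
        using reaches_mono[OF reaches_other[OF j], of ?s "7 * i"] adj[of j] mem less.prems Suc by simp
    next
      case s: True
      define t where "t = partner L ?s"
      have t: "t \<in> trapdoors L" using partner_trapdoor[OF s] by (simp add: t_def)
      note sw_s = reaches_switch[OF _ _ s, folded t_def]
      have 1: "reaches L (Suc (7 * j)) (p 0, Y) (?s, toggle t Y)"
        using sw_s[OF j] adj less.prems Suc Y by simp
      show ?thesis
      proof (cases "?x \<in> switches L")
        case x: False
        show ?thesis
        \<comment> \<open>As \<open>?x\<close> is not in \<open>Y\<close>, stepping back to it is
          illegal only if the landing on \<open>?s\<close> has just opened it.\<close>
        proof (cases "?x = t")
          case False
          have 2: "reaches L (Suc (Suc (7 * j))) (p 0, Y) (?x, toggle t Y)"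
            using reaches_other[OF 1 _ x] adj mem less.prems Suc False by simp
          have "reaches L (Suc (Suc (Suc (7 * j)))) (p 0, Y) (?s, Y)"
            using sw_s[OF 2] adj less.prems Suc Y tog t by simp
          then show ?thesis unfolding Suc by (rule reaches_mono) simp
        next
          case xt: True
          \<comment> \<open>The bounce goes ahead instead; this cell is still on the path because
            \<open>i < k\<close>.\<close>
          let ?q = "p (Suc (Suc j))"
          have q: "?q \<noteq> t" "?q \<in> tiles L" "?q \<notin> Y" "adjacent ?s ?q" "adjacent ?q ?s"
            using neq[of j] xt mem[of "Suc (Suc j)"] adj[of "Suc j"] less.prems Suc by auto
          show ?thesis
          proof (cases "?q \<in> switches L")
            case False
            have 2: "reaches L (Suc (Suc (7 * j))) (p 0, Y) (?q, toggle t Y)"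
              using reaches_other[OF 1 _ False] q by simp
            have "reaches L (Suc (Suc (Suc (7 * j)))) (p 0, Y) (?s, Y)"
              using sw_s[OF 2] q Y tog t by simp
            then show ?thesis unfolding Suc by (rule reaches_mono) simp
          next
            case True
            define u where "u = partner L ?q"
            have u: "u \<in> trapdoors L" using partner_trapdoor[OF True] by (simp add: u_def)
            note sw_q = reaches_switch[OF _ _ True, folded u_def]
            \<comment> \<open>Distinct switches control distinct trapdoors, so \<open>?q\<close>
              does not affect \<open>?x\<close>. The tour \<open>?s ?q ?s ?x ?s ?q ?s\<close> lands
              four times on \<open>?s\<close> and twice on \<open>?q\<close>. The detour to
              \<open>?x\<close> corrects the parity, and is legal because two landings on
              \<open>?s\<close> have closed \<open>?x\<close> again.\<close>
            have "?s \<noteq> ?q" using p(2) less.prems Suc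
              by (auto dest!: inj_onD[of p "{..k}" "Suc j" "Suc (Suc j)"])
            then have ut: "u \<noteq> t" using partner_eq_iff[OF s True] by (simp add: u_def t_def)
            have 2: "reaches L (Suc (Suc (7 * j))) (p 0, Y) (?q, toggle u (toggle t Y))"
              using sw_q[OF 1] q Y tog t by simp
            have 3: "reaches L (Suc (Suc (Suc (7 * j)))) (p 0, Y) (?s, toggle u Y)"
              using sw_s[OF 2] q Y tog t u by (simp add: toggle_commute[of t u])
            have 4: "reaches L (Suc (Suc (Suc (Suc (7 * j))))) (p 0, Y) (?x, toggle u Y)"
              using reaches_other[OF 3 adj(2) x] mem[of j] less.prems Suc ut xt by simp
            have 5: "reaches L (Suc (Suc (Suc (Suc (Suc (7 * j)))))) (p 0, Y) (?s, toggle t (toggle u Y))"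
              using sw_s[OF 4] adj less.prems Suc Y tog u by simp
            have 6: "reaches L (Suc (Suc (Suc (Suc (Suc (Suc (7 * j))))))) (p 0, Y) (?q, toggle t Y)"
              using sw_q[OF 5] q Y tog t u by (simp add: toggle_commute[of t u])
            have "reaches L (Suc (Suc (Suc (Suc (Suc (Suc (Suc (7 * j)))))))) (p 0, Y) (?s, Y)"
              using sw_s[OF 6] q Y tog t by simp
            then show ?thesis unfolding Suc by (rule reaches_mono) simp
          qed
        qed
      next
        case x: True
        \<comment> \<open>Returning to \<open>?x\<close> would toggle its trapdoor as well, so the
          induction hypothesis is applied one cell earlier, which is possible because
          \<open>p 0\<close> is not a switch. The tour is \<open>?x ?s ?x ?s\<close>.\<close>
        then obtain l where l: "j = Suc l" using p(3) by (cases j) auto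
        let ?w = "p l"
        define u where "u = partner L ?x"
        have u: "u \<in> trapdoors L" using partner_trapdoor[OF x] by (simp add: u_def)
        note sw_x = reaches_switch[OF _ _ x, folded u_def]
        have 0: "reaches L (7 * l) (p 0, Y) (?w, Y)" using less Suc l by simp
        have 1: "reaches L (Suc (7 * l)) (p 0, Y) (?x, toggle u Y)"
          using sw_x[OF 0] adj less.prems Suc Y l by simp
        have 2: "reaches L (Suc (Suc (7 * l))) (p 0, Y) (?s, toggle t (toggle u Y))"
          using sw_s[OF 1] adj less.prems Suc Y tog u by simp
        have 3: "reaches L (Suc (Suc (Suc (7 * l)))) (p 0, Y) (?x, toggle t Y)"
          using sw_x[OF 2] adj less.prems Suc Y tog u t by (simp add: toggle_commute[of t u])
        have "reaches L (Suc (Suc (Suc (Suc (7 * l))))) (p 0, Y) (?s, Y)"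
          using sw_s[OF 3] adj less.prems Suc Y tog t by simp
        then show ?thesis unfolding Suc by (rule reaches_mono) (simp add: l)
      qed
    qed
  qed
qed

text \<open>The clean walk stops one cell short of \<open>c\<close>; the landing on \<open>c\<close>
  is left to the caller, who may want its toggling.\<close>

lemma reaches_in_component:
  assumes "Y \<subseteq> trapdoors L" "connected_in (tiles L - Y) h c" "h \<notin> switches L"
  obtains "c = h"
  | b where "reaches L (7 * num_tiles L) (h, Y) (b, Y)" "adjacent b c"
      "b \<in> tiles L" "b \<notin> Y"
proof -
  obtain p k where p: "path (tiles L - Y) p k" "p 0 = h" "p k = c" "inj_on p {..k}"
    using assms(2) by (rule simple_path)
  have "k < card (tiles L - Y)" using p finite_tiles by (intro simple_path_length[of _ p]) auto
  also have "\<dots> \<le> num_tiles L"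
    unfolding num_tiles_def using finite_tiles by (intro card_mono) auto
  finally have k: "k < num_tiles L" .
  show ?thesis
  proof (cases k)
    case 0
    then show ?thesis using p that(1) by simp
  next
    case (Suc j)
    have "reaches L (7 * j) (h, Y) (p j, Y)"
      using clean_walk[OF assms(1) p(1,4), of j] p assms(3) Suc by simp
    then have "reaches L (7 * num_tiles L) (h, Y) (p j, Y)"
      by (rule reaches_mono) (use k Suc in simp)
    then show ?thesis using that(2)[of "p j"] p Suc by (auto simp: path_def)
  qed
qed

lemma explored_antimono:
  assumes "c \<in> explored L Y q" "X \<subseteq> Y"
  shows "c \<in> explored L X q"
  using assms(1)
proof (induction rule: explored.induct)
  case (not_open c c')
  then show ?case using assms(2) by (blast intro: explored.not_open)
qed (blast intro: explored.intros)+

text \<open>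
  After a walk from a home cell that is not a switch to a switch \<open>s\<close>, the reversed walk
  restores every trapdoor but that of \<open>s\<close>.
\<close>

lemma close_trapdoor:
  assumes X: "X \<subseteq> trapdoors L" and h: "h \<in> tiles L - X" "h \<notin> switches L"
    and s: "connected_in (tiles L - X) h s" "s \<in> switches L" "partner L s \<in> X"
  shows "reaches L (14 * num_tiles L + 2) (h, X) (h, X - {partner L s})"
proof -
  let ?n = "num_tiles L"
  define Y where "Y = X - {partner L s}"
  have Y: "Y \<subseteq> trapdoors L" "toggle (partner L s) X = Y" "toggle (partner L s) Y = X"
    using X s by (auto simp: Y_def toggle_def)
  \<comment> \<open>For the way back, a second walk is planned from \<open>h\<close> in state
    \<open>Y\<close>, where the same path is available, and then reversed.\<close>
  have conn: "connected_in (tiles L - Y) h s"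
    using s(1) unfolding connected_in_def path_def Y_def by blast
  have "h \<noteq> s" using s h by blast
  with reaches_in_component[OF X s(1) h(2)]
  obtain b where b: "reaches L (7 * ?n) (h, X) (b, X)" "adjacent b s" by metis
  from \<open>h \<noteq> s\<close> reaches_in_component[OF Y(1) conn h(2)]
  obtain c where c: "reaches L (7 * ?n) (h, Y) (c, Y)" "adjacent c s" by metis
  have "reaches L (Suc (7 * ?n)) (h, X) (s, Y)"
    using reaches_switch[OF b s(2) X] Y by simp
  moreover have "reaches L (Suc (7 * ?n)) (s, Y) (h, Y)"
  proof -
    have "reaches L (Suc (7 * ?n)) (h, Y) (s, X)"
      using reaches_switch[OF c s(2) Y(1)] Y by simp
    from reaches_reverse[OF this] show ?thesis using h s Y by (simp add: Y_def)
  qed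
  ultimately show ?thesis using reaches_trans unfolding Y_def by fastforce
qed

text \<open>If no switch of the component controls an open trapdoor, then \<open>unlocked\<close>
  yields only cells outside \<open>X\<close>, and the closure stays in the component.\<close>

lemma explored_component:
  assumes "q \<in> tiles L - X"
    and "\<And>s. connected_in (tiles L - X) q s \<Longrightarrow> s \<in> switches L \<Longrightarrow> partner L s \<notin> X"
    and "c \<in> explored L X q"
  shows "connected_in (tiles L - X) q c"
  using assms(3)
proof (induction rule: explored.induct)
  case base
  then show ?case using assms(1) by (rule connected_in_refl)
next
  case (not_open c c')
  then show ?case by (intro connected_in_step[of _ _ c c']) auto
next
  case (unlocked c c' s)
  then show ?case using assms(2)[of s] by (intro connected_in_step[of _ _ c c']) auto
qed

text \<open>Induction on the number of open trapdoors. While a switch in the component of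
  \<open>h\<close> controls an open one, closing it costs one factor
  \<open>14 * num_tiles L + 2\<close> and keeps \<open>c\<close> in the closure. Otherwise the
  closure lies in the component, and the \<open>+ 1\<close> pays for a final walk.\<close>

lemma explored_reachable:
  assumes "X \<subseteq> trapdoors L" "h \<in> tiles L - X" "h \<notin> switches L" "c \<in> explored L X h"
  shows "\<exists>Y. reaches L ((14 * num_tiles L + 2) * (card X + 1)) (h, X) (c, Y)"
  using assms
proof (induction "card X" arbitrary: X rule: less_induct)
  case less
  let ?n = "num_tiles L"
  show ?case
  proof (cases "\<exists>s. connected_in (tiles L - X) h s \<and> s \<in> switches L \<and> partner L s \<in> X")
    case True
    then obtain s where s: "connected_in (tiles L - X) h s" "s \<in> switches L" "partner L s \<in> X"
      by blast
    let ?Y = "X - {partner L s}"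
    have "card ?Y < card X" using s less.prems finite_open by (intro psubset_card_mono) auto
    moreover have "c \<in> explored L ?Y h" using less.prems(4) by (rule explored_antimono) auto
    ultimately obtain Z where "reaches L ((14 * ?n + 2) * (card ?Y + 1)) (h, ?Y) (c, Z)"
      using less by blast
    from reaches_trans[OF close_trapdoor[OF less.prems(1-3) s] this]
    have "reaches L ((14 * ?n + 2) * (card ?Y + 1 + 1)) (h, X) (c, Z)" by simp
    then have "reaches L ((14 * ?n + 2) * (card X + 1)) (h, X) (c, Z)"
      by (rule reaches_mono) (use \<open>card ?Y < card X\<close> in \<open>intro mult_le_mono; simp\<close>)
    then show ?thesis by blast
  next
    case False
    then have c: "connected_in (tiles L - X) h c"
      using explored_component less.prems by blast
    show ?thesis
    proof (rule reaches_in_component[OF less.prems(1) c less.prems(3)])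
      assume "c = h"
      then show ?thesis using reaches_refl by blast
    next
      fix b
      assume b: "reaches L (7 * ?n) (h, X) (b, X)" "adjacent b c"
      have "reaches L (Suc (7 * ?n)) (h, X) (c, land_on L c X)"
        using connected_in_members(2)[OF c] by (intro reaches_snoc[OF b]) auto
      then have "reaches L ((14 * ?n + 2) * (card X + 1)) (h, X) (c, land_on L c X)"
        by (rule reaches_mono) simp
      then show ?thesis by blast
    qed
  qed
qed

section \<open>Starting on a switch\<close>

text \<open>Switches are never trapdoors, so a walk over switches is legal whatever it
  toggles.\<close>

lemma switch_walk:
  assumes "path (switches L) p k" "X \<subseteq> trapdoors L"
  shows "\<exists>Y. reaches L k (p 0, X) (p k, Y) \<and> Y \<subseteq> trapdoors L \<and>
    (\<forall>t. t \<notin> partner L ` p ` {0<..k} \<longrightarrow> (t \<in> Y \<longleftrightarrow> t \<in> X))"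
  using assms(1)
proof (induction k)
  case 0
  show ?case using assms(2) reaches_refl by blast
next
  case (Suc k)
  then have "path (switches L) p k" and k: "adjacent (p k) (p (Suc k))" "p (Suc k) \<in> switches L"
    by (auto simp: path_def)
  then obtain Y where Y: "reaches L k (p 0, X) (p k, Y)" "Y \<subseteq> trapdoors L"
    "\<And>t. t \<notin> partner L ` p ` {0<..k} \<Longrightarrow> t \<in> Y \<longleftrightarrow> t \<in> X" using Suc.IH by blast
  have "reaches L (Suc k) (p 0, X) (p (Suc k), toggle (partner L (p (Suc k))) Y)"
    using reaches_switch[OF Y(1) k Y(2)] .
  moreover have "toggle (partner L (p (Suc k))) Y \<subseteq> trapdoors L"
    using Y(2) partner_trapdoor[OF k(2)] by (auto simp: toggle_def)
  moreover have "t \<in> toggle (partner L (p (Suc k))) Y \<longleftrightarrow> t \<in> X"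
    if "t \<notin> partner L ` p ` {0<..Suc k}" for t
  proof -
    have "t \<noteq> partner L (p (Suc k))" using that by auto
    moreover have "t \<notin> partner L ` p ` {0<..k}" using that by (auto simp: image_iff)
    ultimately show ?thesis using Y(3) by auto
  qed
  ultimately show ?case by blast
qed

text \<open>The first cell of a walk is not landed on and a simple path does not return to it, so
  the trapdoor of \<open>a\<close> keeps its state. Thus a trapdoor can be closed at its switch
  before walking on.\<close>

lemma switch_component_walk:
  assumes "connected_in (switches L) a b" "X \<subseteq> trapdoors L"
  shows "\<exists>Y. reaches L (num_tiles L) (a, X) (b, Y) \<and> Y \<subseteq> trapdoors L \<and>
    (partner L a \<in> Y \<longleftrightarrow> partner L a \<in> X) \<and>
    (\<forall>t. t \<notin> partner L ` {s. connected_in (switches L) a s} \<longrightarrow> (t \<in> Y \<longleftrightarrow> t \<in> X))"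
proof -
  obtain p k where p: "path (switches L) p k" "p 0 = a" "p k = b" "inj_on p {..k}"
    using assms(1) by (rule simple_path)
  obtain Y where Y: "reaches L k (a, X) (b, Y)" "Y \<subseteq> trapdoors L"
    "\<And>t. t \<notin> partner L ` p ` {0<..k} \<Longrightarrow> t \<in> Y \<longleftrightarrow> t \<in> X"
    using switch_walk[OF p(1) assms(2)] p by blast
  have k: "k \<le> num_tiles L"
    using simple_path_length[OF p(1,4) finite_switches] card_switches by linarith
  have pc: "connected_in (switches L) a (p i)" if "i \<le> k" for i
    using p that unfolding connected_in_def path_def
    by (intro exI[of _ p] exI[of _ i]) auto
  have "partner L a \<notin> partner L ` p ` {0<..k}"
  proof
    assume "partner L a \<in> partner L ` p ` {0<..k}"
    then obtain i where "0 < i" "i \<le> k" "partner L (p 0) = partner L (p i)"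
      using p(2) by auto
    moreover from this have "p 0 = p i"
      using partner_eq_iff p(1) unfolding path_def by blast
    ultimately show False using inj_onD[OF p(4), of 0 i] by simp
  qed
  then have 4: "partner L a \<in> Y \<longleftrightarrow> partner L a \<in> X" by (rule Y(3))
  have "t \<in> Y \<longleftrightarrow> t \<in> X" if "t \<notin> partner L ` {s. connected_in (switches L) a s}" for t
  proof (rule Y(3))
    show "t \<notin> partner L ` p ` {0<..k}" using that pc by auto
  qed
  with 4 show ?thesis using reaches_mono[OF Y(1) k] Y(2) by blast
qed

text \<open>The exit \<open>h\<close> must be closed when the cube is on \<open>s\<close>. If no
  switch of the component controls it, any walk to \<open>s\<close> will do. Otherwise the cube
  visits the controlling switch \<open>u\<close>, lands on it once more if \<open>h\<close> is open,
  and goes to \<open>s\<close> without returning to \<open>u\<close>. The bound counts two walks,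
  two moves for the extra landing and the step to \<open>h\<close>.\<close>

lemma leave_switches:
  assumes X: "X \<subseteq> trapdoors L" and q: "q \<in> switches L"
    and a: "adjacent q a" "a \<in> tiles L" "a \<notin> X"
    and h: "h \<in> tiles L" "h \<notin> switches L" "connected_in (switches L) q s" "adjacent s h"
      "h \<notin> X \<or> h \<in> partner L ` {s. connected_in (switches L) q s}"
  shows "\<exists>h s Y. h \<in> tiles L - Y \<and> h \<notin> switches L \<and> connected_in (switches L) q s \<and> adjacent s h \<and>
    Y \<subseteq> trapdoors L \<and> reaches L (2 * num_tiles L + 3) (q, X) (h, Y) \<and>
    (\<forall>t. t \<notin> partner L ` {s. connected_in (switches L) q s} \<longrightarrow> (t \<in> Y \<longleftrightarrow> t \<in> X))"
proof (cases "a \<in> switches L")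
  case False
  have "reaches L (2 * num_tiles L + 3) (q, X) (a, X)"
    using reaches_mono[OF reaches_other[OF reaches_refl[of L 0] a(1) False a(2,3)]] by simp
  then show ?thesis using False a X connected_in_refl[OF q] by blast
next
  case True
  let ?n = "num_tiles L"
  define K where "K = {s. connected_in (switches L) q s}"
  have K_switch: "b \<in> K \<Longrightarrow> b \<in> switches L" for b
    unfolding K_def using connected_in_members(2) by blast
  have K_conn: "connected_in (switches L) u b" if "u \<in> K" "b \<in> K" for u b
    using that connected_in_sym connected_in_trans unfolding K_def by blast
  have K_eq: "{b. connected_in (switches L) u b} = K" if "u \<in> K" for u
    using that connected_in_trans K_conn unfolding K_def by blast
  have K_step: "b \<in> K" if "u \<in> K" "adjacent u b" "b \<in> switches L" for u b
    using that connected_in_step unfolding K_def by blast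
  have walk: "\<exists>Y. reaches L ?n (u, X) (b, Y) \<and> Y \<subseteq> trapdoors L \<and>
      (partner L u \<in> Y \<longleftrightarrow> partner L u \<in> X) \<and> (\<forall>t. t \<notin> partner L ` K \<longrightarrow> (t \<in> Y \<longleftrightarrow> t \<in> X))"
    if "u \<in> K" "b \<in> K" "X \<subseteq> trapdoors L" for u b X
    using switch_component_walk[OF K_conn[OF that(1,2)] that(3)] unfolding K_eq[OF that(1)] .
  have "q \<in> K" using connected_in_refl[OF q] by (simp add: K_def)
  have "s \<in> K" using h by (simp add: K_def)
  have "\<exists>Y. h \<notin> Y \<and> Y \<subseteq> trapdoors L \<and> reaches L (2 * ?n + 2) (q, X) (s, Y) \<and>
    (\<forall>t. t \<notin> partner L ` K \<longrightarrow> (t \<in> Y \<longleftrightarrow> t \<in> X))"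
  proof (cases "h \<in> partner L ` K")
    case False
    obtain Y where "reaches L ?n (q, X) (s, Y)" "Y \<subseteq> trapdoors L"
      "\<And>t. t \<notin> partner L ` K \<Longrightarrow> t \<in> Y \<longleftrightarrow> t \<in> X"
      using walk[OF \<open>q \<in> K\<close> \<open>s \<in> K\<close> X] by blast
    moreover from this have "h \<notin> Y" using False h(5) unfolding K_def by blast
    ultimately show ?thesis using reaches_mono[of L ?n _ _ "2 * ?n + 2"] by (intro exI[of _ Y]) simp
  next
    case True
    then obtain u where u: "u \<in> K" "h = partner L u" by blast
    obtain Z where Z: "reaches L ?n (q, X) (u, Z)" "Z \<subseteq> trapdoors L"
      "\<And>t. t \<notin> partner L ` K \<Longrightarrow> t \<in> Z \<longleftrightarrow> t \<in> X"
      using walk[OF \<open>q \<in> K\<close> u(1) X] by blast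
    \<comment> \<open>A switch to bounce off: the given \<open>a\<close> if \<open>u = q\<close>,
      otherwise the next one on a path to \<open>q\<close>.\<close>
    obtain b where b: "adjacent u b" "b \<in> K"
    proof (cases "u = q")
      case True
      then show ?thesis using that a \<open>a \<in> switches L\<close> K_step[OF \<open>q \<in> K\<close>] by blast
    next
      case False
      obtain p k where p: "path (switches L) p k" "p 0 = u" "p k = q"
        using K_conn[OF u(1) \<open>q \<in> K\<close>] unfolding connected_in_def by blast
      with False have "0 < k" by (metis gr0I)
      then have "adjacent u (p 1)" "p 1 \<in> switches L" using p by (auto simp: path_def)
      then show ?thesis using that K_step u(1) by blast
    qed
    have "b \<noteq> u" using b(1) by (cases u) (auto simp: adjacent_iff)
    then have pb: "partner L b \<noteq> h" using partner_eq_iff K_switch b u by blast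
    have pt: "partner L b \<in> trapdoors L" "h \<in> trapdoors L"
      using partner_trapdoor K_switch b u by auto
    obtain Z' where Z': "reaches L (?n + 2) (q, X) (u, Z')" "Z' \<subseteq> trapdoors L" "h \<notin> Z'"
      "\<And>t. t \<notin> partner L ` K \<Longrightarrow> t \<in> Z' \<longleftrightarrow> t \<in> X"
    proof (cases "h \<in> Z")
      case False
      then show ?thesis using that[of Z] Z reaches_mono[OF Z(1), of "?n + 2"] by auto
    next
      case True
      have sub: "toggle (partner L b) Z \<subseteq> trapdoors L" "toggle h (toggle (partner L b) Z) \<subseteq> trapdoors L"
        using Z(2) pt by (auto simp: toggle_def)
      have "reaches L (Suc ?n) (q, X) (b, toggle (partner L b) Z)"
        using reaches_switch[OF Z(1) b(1)] K_switch b Z by blast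
      from reaches_switch[OF this adjacent_sym[OF b(1)]] K_switch[OF u(1)] sub(1)
      have "reaches L (?n + 2) (q, X) (u, toggle h (toggle (partner L b) Z))"
        by (simp add: u)
      moreover have "t \<in> toggle h (toggle (partner L b) Z) \<longleftrightarrow> t \<in> X" if "t \<notin> partner L ` K" for t
        using that Z(3) b u by auto
      ultimately show ?thesis using that sub(2) True pb by simp
    qed
    obtain W where W: "reaches L ?n (u, Z') (s, W)" "W \<subseteq> trapdoors L" "h \<in> W \<longleftrightarrow> h \<in> Z'"
      "\<And>t. t \<notin> partner L ` K \<Longrightarrow> t \<in> W \<longleftrightarrow> t \<in> Z'"
      using walk[OF u(1) \<open>s \<in> K\<close> Z'(2)] unfolding u(2)[symmetric] by blast
    have "reaches L (2 * ?n + 2) (q, X) (s, W)"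
      using reaches_trans[OF Z'(1) W(1)] by (simp add: mult_2 add.commute add.left_commute)
    then show ?thesis using W Z'(3,4) by (intro exI[of _ W]) simp
  qed
  then obtain Y where Y: "h \<notin> Y" "Y \<subseteq> trapdoors L" "reaches L (2 * ?n + 2) (q, X) (s, Y)"
    "\<forall>t. t \<notin> partner L ` K \<longrightarrow> (t \<in> Y \<longleftrightarrow> t \<in> X)" by blast
  have "reaches L (2 * ?n + 3) (q, X) (h, Y)"
    using reaches_other[OF Y(3) h(4,2,1) Y(1)] by (simp add: numeral_eq_Suc)
  then show ?thesis using h Y unfolding K_def by blast
qed

text \<open>Nothing is lost by making \<open>h\<close> the home cell: \<open>Y\<close> differs from
  \<open>X\<close> only in trapdoors controlled by \<open>K\<close>, and all of \<open>K\<close> is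
  explored from \<open>h\<close>, since switches can always be entered.\<close>

lemma explored_reachable_from_switch:
  assumes X: "X \<subseteq> trapdoors L" and q: "q \<in> switches L"
    and a: "adjacent q a" "a \<in> tiles L" "a \<notin> X"
    and c: "c \<in> explored L X q"
  shows "\<exists>Y. reaches L (2 * num_tiles L + 3 + (14 * num_tiles L + 2) * (num_tiles L + 1)) (q, X) (c, Y)"
proof -
  let ?n = "num_tiles L"
  define K where "K = {s. connected_in (switches L) q s}"
  have "q \<in> K" using connected_in_refl[OF q] by (simp add: K_def)
  show ?thesis
  proof (cases "c \<in> K")
    case True
    then obtain Y where "reaches L ?n (q, X) (c, Y)"
      using switch_component_walk[of q c X] X unfolding K_def by blast
    then have "reaches L (2 * ?n + 3 + (14 * ?n + 2) * (?n + 1)) (q, X) (c, Y)"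
      by (rule reaches_mono) simp
    then show ?thesis by blast
  next
    case False
    \<comment> \<open>Without such an exit, \<open>K\<close> would be closed under the rules of
      \<open>explored\<close> and hence contain \<open>c\<close>.\<close>
    have "\<exists>s h. h \<in> tiles L \<and> h \<notin> switches L \<and> s \<in> K \<and> adjacent s h \<and> (h \<notin> X \<or> h \<in> partner L ` K)"
    proof (rule ccontr)
      assume no: "\<not> ?thesis"
      have K_step: "h \<in> K" if "s \<in> K" "adjacent s h" "h \<in> tiles L" "h \<notin> X \<or> h \<in> partner L ` K" for s h
      proof (cases "h \<in> switches L")
        case True
        then show ?thesis using that connected_in_step unfolding K_def by blast
      next
        case False
        then show ?thesis using that no by blast
      qed
      from c have "c \<in> K"
      proof (induction rule: explored.induct)
        case base
        show ?case by (rule \<open>q \<in> K\<close>)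
      qed (blast intro: K_step)+
      with False show False by blast
    qed
    then obtain s1 h1 where "h1 \<in> tiles L" "h1 \<notin> switches L" "connected_in (switches L) q s1"
      "adjacent s1 h1" "h1 \<notin> X \<or> h1 \<in> partner L ` {s. connected_in (switches L) q s}"
      unfolding K_def by blast
    from leave_switches[OF X q a this] obtain h s Y where
      h: "h \<in> tiles L - Y" "h \<notin> switches L" "s \<in> K" "adjacent s h" and Y: "Y \<subseteq> trapdoors L"
      "reaches L (2 * ?n + 3) (q, X) (h, Y)" "\<And>t. t \<notin> partner L ` K \<Longrightarrow> t \<in> Y \<longleftrightarrow> t \<in> X"
      unfolding K_def mem_Collect_eq by blast
    have not_Y: "b \<notin> Y" if "b \<in> switches L" for b using that Y(1) switch_not_trapdoor by blast
    have K: "b \<in> explored L Y h" if "b \<in> K" for b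
    proof -
      have "connected_in (switches L) s b"
        using that h(3) connected_in_sym connected_in_trans unfolding K_def by blast
      then show ?thesis
      proof (induction rule: connected_in_induct)
        case base
        have "s \<in> switches L" using h(3) connected_in_members(2) unfolding K_def by blast
        then show ?case
          using explored.not_open[OF explored.base adjacent_sym[OF h(4)]] not_Y switch_tile by blast
      next
        case (step y z)
        then show ?case using explored.not_open not_Y switch_tile by blast
      qed
    qed
    from c have "c \<in> explored L Y h"
    proof (induction rule: explored.induct)
      case base
      show ?case using \<open>q \<in> K\<close> by (rule K)
    next
      case (not_open d d')
      show ?case
      proof (cases "d' \<in> partner L ` K")
        case True
        then obtain u where "u \<in> K" "d' = partner L u" by blast
        moreover from this have "u \<in> switches L" using connected_in_members(2) unfolding K_def by blast
        ultimately show ?thesis using explored.unlocked[OF not_open.IH] K not_open by blast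
      next
        case False
        then show ?thesis using explored.not_open[OF not_open.IH] not_open Y(3) by blast
      qed
    next
      case (unlocked d d' u)
      then show ?case using explored.unlocked by blast
    qed
    from explored_reachable[OF Y(1) h(1,2) this] obtain Z where
      "reaches L ((14 * ?n + 2) * (card Y + 1)) (h, Y) (c, Z)" by blast
    from reaches_trans[OF Y(2) this]
    have "reaches L (2 * ?n + 3 + (14 * ?n + 2) * (?n + 1)) (q, X) (c, Z)"
      by (rule reaches_mono) (use card_open[OF Y(1)] in \<open>intro add_mono mult_le_mono; simp\<close>)
    then show ?thesis by blast
  qed
qed

section \<open>Solutions stay in the closure; the solvability criterion\<close>

text \<open>A trapdoor that was open in \<open>X\<close> and is closed now must have had its switch
  landed on. This second conjunct is what puts the next cell into the closure when that cell was
  open in \<open>X\<close>.\<close>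

lemma explored_invariant:
  assumes "X \<subseteq> trapdoors L" "make_moves L ds (q, X) = Some (c, Y)"
  shows "c \<in> explored L X q \<and> (\<forall>t\<in>X - Y. \<exists>s\<in>switches L. s \<in> explored L X q \<and> partner L s = t)"
  using assms(2)
proof (induction rule: make_moves_induct)
  case (Nil c Y)
  then show ?case by (auto intro: explored.base)
next
  case (Snoc n c Y c' Y')
  have c': "c' \<in> explored L X q"
  proof (cases "c' \<in> X")
    case True
    with Snoc have "c' \<in> X - Y" by auto
    then show ?thesis using Snoc explored.unlocked by blast
  next
    case False
    then show ?thesis using Snoc explored.not_open by blast
  qed
  moreover have "\<exists>s\<in>switches L. s \<in> explored L X q \<and> partner L s = t" if "t \<in> X - Y'" for t
  proof (cases "t \<in> Y")
    case True
    with that Snoc(4) have "c' \<in> switches L \<and> partner L c' = t" by (auto simp: land_on_def split: if_splits)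
    with c' show ?thesis by blast
  next
    case False
    then show ?thesis using Snoc that by blast
  qed
  ultimately show ?case by blast
qed

text \<open>
  The first move is singled out because a cube starting on an open trapdoor may be unable to
  return, and the second because a cube stuck on a switch cannot use it.
\<close>

definition solvability_test :: bool where
  "solvability_test \<longleftrightarrow> goal L = start L \<or>
     (\<exists>q\<in>tiles L. adjacent (start L) q \<and> q \<notin> initially_open L \<and>
        (goal L = q \<or>
          (\<exists>r\<in>tiles L. adjacent q r \<and> r \<notin> land_on L q (initially_open L)) \<and>
          goal L \<in> explored L (land_on L q (initially_open L)) q))"

lemma open_trapdoors: "initially_open L \<subseteq> trapdoors L"
  using valid by (simp add: valid_level_def)

lemma solution_reaches:
  "reaches L k (start L, initially_open L) (goal L, X) \<Longrightarrow> \<exists>ds. solution L ds \<and> length ds \<le> k"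
  unfolding reaches_def solution_def by blast

lemma solvable_imp_test:
  assumes "solvable L"
  shows solvability_test
proof -
  obtain ds X where ds: "make_moves L ds (start L, initially_open L) = Some (goal L, X)"
    using assms unfolding solvable_def solution_def by blast
  show ?thesis
  proof (cases ds)
    case Nil
    then show ?thesis using ds by (simp add: solvability_test_def)
  next
    case (Cons d es)
    then obtain q Y where q: "make_move L d (start L, initially_open L) = Some (q, Y)"
      "make_moves L es (q, Y) = Some (goal L, X)"
      using ds by (auto split: Option.bind_splits)
    have q': "adjacent (start L) q" "q \<in> tiles L" "Y = land_on L q (initially_open L)" "q \<notin> initially_open L"
      using make_move_iff[of L "start L" "initially_open L" q Y] q(1) by auto
    show ?thesis
    proof (cases es)
      case Nil
      then show ?thesis using q q' by (auto simp: solvability_test_def)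
    next
      case (Cons e fs)
      then obtain r Z where "make_move L e (q, Y) = Some (r, Z)"
        using q(2) by (auto split: Option.bind_splits)
      then have r: "adjacent q r" "r \<in> tiles L" "r \<notin> Y"
        using make_move_iff[of L q Y r Z] by auto
      have "goal L \<in> explored L Y q"
        using explored_invariant[OF _ q(2)] land_on_trapdoors[OF open_trapdoors] q' by blast
      then show ?thesis using q' r unfolding solvability_test_def by blast
    qed
  qed
qed

lemma test_imp_short_solution:
  assumes solvability_test
  shows "\<exists>ds. solution L ds \<and> length ds \<le> 50 * num_tiles L ^ 2"
proof -
  let ?n = "num_tiles L"
  let ?k = "2 * ?n + 3 + (14 * ?n + 2) * (?n + 1)"
  have "start L \<in> tiles L" using valid by (simp add: valid_level_def)
  then have "?n \<ge> 1" unfolding num_tiles_def using finite_tiles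
    by (metis Suc_leI card_gt_0_iff empty_iff One_nat_def)
  then obtain m where m: "?n = Suc m" by (cases ?n) auto
  \<comment> \<open>The left side is \<open>14 * ?n ^ 2 + 18 * ?n + 6\<close>, at most
    \<open>38 * ?n ^ 2\<close> for \<open>?n \<ge> 1\<close>; the constant 50 leaves room.\<close>
  have k: "1 + ?k \<le> 50 * ?n ^ 2" unfolding m by (simp add: power2_eq_square algebra_simps)
  have "\<exists>X. reaches L (1 + ?k) (start L, initially_open L) (goal L, X)"
  proof (cases "goal L = start L")
    case True
    then show ?thesis using reaches_refl by metis
  next
    case False
    then obtain q where q: "q \<in> tiles L" "adjacent (start L) q" "q \<notin> initially_open L"
      and q': "goal L = q \<or>
          (\<exists>r\<in>tiles L. adjacent q r \<and> r \<notin> land_on L q (initially_open L)) \<and>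
          goal L \<in> explored L (land_on L q (initially_open L)) q"
      using assms unfolding solvability_test_def by blast
    define X where "X = land_on L q (initially_open L)"
    have X: "X \<subseteq> trapdoors L" unfolding X_def using land_on_trapdoors open_trapdoors by blast
    have "q \<notin> X" using q by (simp add: X_def)
    have 1: "reaches L 1 (start L, initially_open L) (q, X)"
      using reaches_one[OF q(2,1)] q by (simp add: X_def)
    have "\<exists>Y. reaches L ?k (q, X) (goal L, Y)"
    proof (cases "goal L = q")
      case True
      then show ?thesis using reaches_refl by metis
    next
      case False
      with q' obtain r where r: "r \<in> tiles L" "adjacent q r" "r \<notin> X"
        and g: "goal L \<in> explored L X q" unfolding X_def by blast
      show ?thesis
      proof (cases "q \<in> switches L")
        case True
        then show ?thesis using explored_reachable_from_switch X r g by blast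
      next
        case False
        obtain Y where "reaches L ((14 * ?n + 2) * (card X + 1)) (q, X) (goal L, Y)"
          using explored_reachable[OF X _ False g] q \<open>q \<notin> X\<close> by blast
        moreover have "(14 * ?n + 2) * (card X + 1) \<le> ?k"
          by (rule trans_le_add2, intro mult_le_mono add_mono order_refl card_open[OF X])
        ultimately show ?thesis using reaches_mono by blast
      qed
    qed
    then show ?thesis using reaches_trans[OF 1] by blast
  qed
  then show ?thesis using solution_reaches k by (meson le_trans)
qed

lemma solvable_iff: "solvable L \<longleftrightarrow> solvability_test"
  using solvable_imp_test test_imp_short_solution unfolding solvable_def by blast

end

section \<open>Lower bound\<close>

text \<open>
  On a line, the cells \<open>m + j\<close> and \<open>- (m + j)\<close> for \<open>1 \<le> j \<le> K\<close> hold a switch and its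
  trapdoor, the switch being on the right for odd \<open>j\<close>.  The goal is the last trapdoor.  The
  flag \<open>e\<close> adds an isolated tile, since the line has an odd number of them.
\<close>

definition shuttle :: "nat \<Rightarrow> nat \<Rightarrow> bool \<Rightarrow> level" where
  "shuttle m K e =
     \<lparr>tile_at = (\<lambda>(x, y).
        if y = 0 \<and> \<bar>x\<bar> \<le> int (m + K) then
          Some (if \<bar>x\<bar> \<le> int m then Normal
            else if (0 < x) = odd (\<bar>x\<bar> - int m) then Switch else Trapdoor)
        else if e \<and> x = 0 \<and> y = 2 then Some Normal else None),
      partner = (\<lambda>(x, y). (- x, y)),
      initially_open =
        {(x, 0) | x. int m < \<bar>x\<bar> \<and> \<bar>x\<bar> \<le> int (m + K) \<and> (0 < x) \<noteq> odd (\<bar>x\<bar> - int m)},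
      start = (0, 0),
      goal = (if odd K then - int (m + K) else int (m + K), 0)\<rparr>"

lemma shuttle_simps:
  "partner (shuttle m K e) = (\<lambda>(x, y). (- x, y))"
  "start (shuttle m K e) = (0, 0)"
  "goal (shuttle m K e) = (if odd K then - int (m + K) else int (m + K), 0)"
  by (simp_all add: shuttle_def)

lemma shuttle_tile_iff:
  "(x, y) \<in> tiles (shuttle m K e) \<longleftrightarrow> y = 0 \<and> \<bar>x\<bar> \<le> int (m + K) \<or> e \<and> x = 0 \<and> y = 2"
  by (auto simp: shuttle_def tiles_def dom_def split: if_splits)

lemma shuttle_switch_iff:
  "(x, y) \<in> switches (shuttle m K e) \<longleftrightarrow>
     y = 0 \<and> int m < \<bar>x\<bar> \<and> \<bar>x\<bar> \<le> int (m + K) \<and> (0 < x) = odd (\<bar>x\<bar> - int m)"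
  by (auto simp: shuttle_def tiles_of_kind_def split: if_splits)

lemma shuttle_trapdoor_iff:
  "(x, y) \<in> trapdoors (shuttle m K e) \<longleftrightarrow>
     y = 0 \<and> int m < \<bar>x\<bar> \<and> \<bar>x\<bar> \<le> int (m + K) \<and> (0 < x) \<noteq> odd (\<bar>x\<bar> - int m)"
  by (auto simp: shuttle_def tiles_of_kind_def split: if_splits)

lemma shuttle_open: "initially_open (shuttle m K e) = trapdoors (shuttle m K e)"
proof -
  have "initially_open (shuttle m K e) =
      {(x, 0) | x. int m < \<bar>x\<bar> \<and> \<bar>x\<bar> \<le> int (m + K) \<and> (0 < x) \<noteq> odd (\<bar>x\<bar> - int m)}"
    by (simp add: shuttle_def)
  also have "\<dots> = trapdoors (shuttle m K e)"
    by (intro set_eqI) (clarsimp simp: shuttle_trapdoor_iff; blast)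
  finally show ?thesis .
qed

lemma shuttle_tiles:
  "tiles (shuttle m K e) = {- int (m + K)..int (m + K)} \<times> {0} \<union> (if e then {(0, 2)} else {})"
  by (auto simp: shuttle_tile_iff)

lemma shuttle_num_tiles: "num_tiles (shuttle m K e) = 2 * (m + K) + 1 + (if e then 1 else 0)"
proof -
  have "card ({- int (m + K)..int (m + K)} \<times> {0 :: int}) = 2 * (m + K) + 1"
    by (simp add: card_cartesian_product)
  moreover have "(0, 2) \<notin> {- int (m + K)..int (m + K)} \<times> {0 :: int}" by auto
  ultimately show ?thesis unfolding num_tiles_def shuttle_tiles by auto
qed

lemma shuttle_valid: "valid_level (shuttle m K e)"
proof -
  let ?L = "shuttle m K e"
  have "finite (tiles ?L)" unfolding shuttle_tiles by auto
  moreover have "bij_betw (partner ?L) (switches ?L) (trapdoors ?L)"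
    by (rule bij_betw_byWitness[where f' = "partner ?L"])
      (auto simp: shuttle_simps shuttle_switch_iff shuttle_trapdoor_iff)
  moreover have "start ?L \<in> tiles ?L" "goal ?L \<in> tiles ?L"
    by (auto simp: shuttle_simps shuttle_tile_iff)
  ultimately show ?thesis by (auto simp: valid_level_def shuttle_open)
qed

text \<open>Going outwards, each switch is adjacent to the preceding cell on its own side, and its
  discovery unlocks the mirror image.\<close>

lemma shuttle_explored:
  assumes "i \<le> m + K"
  shows "(int i, 0) \<in> explored (shuttle m K e) (trapdoors (shuttle m K e)) (0, 0) \<and>
    (- int i, 0) \<in> explored (shuttle m K e) (trapdoors (shuttle m K e)) (0, 0)"
  using assms
proof (induction i)
  case 0
  show ?case by (simp add: explored.base)
next
  case (Suc i)
  let ?L = "shuttle m K e"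
  let ?E = "explored ?L (trapdoors ?L) (0, 0)"
  have closed: "(x', 0) \<in> ?E"
    if "\<bar>x\<bar> = int i" "\<bar>x'\<bar> = int (Suc i)" "x' = x + 1 \<or> x = x' + 1" "(x', 0) \<notin> trapdoors ?L" for x x'
  proof (rule explored.not_open[of "(x, 0)"])
    have "x = int i \<or> x = - int i" using that by linarith
    then show "(x, 0) \<in> ?E" using Suc by auto
    show "adjacent (x, 0) (x', 0)" using that by (auto simp: adjacent_iff)
    show "(x', 0) \<in> tiles ?L" using that Suc.prems by (simp add: shuttle_tile_iff)
  qed (use that in auto)
  show ?case
  proof (cases "Suc i \<le> m")
    case True
    then show ?thesis
      by (intro conjI closed[of "int i" "int (Suc i)"] closed[of "- int i" "- int (Suc i)"])
        (simp_all add: shuttle_trapdoor_iff)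
  next
    case False
    \<comment> \<open>The side on which the switch lies.\<close>
    define a :: int where "a = (if odd (int (Suc i) - int m) then 1 else - 1)"
    have a: "a = 1 \<or> a = - 1" by (simp add: a_def)
    have s: "(a * int (Suc i), 0) \<in> switches ?L"
      using False Suc.prems by (auto simp: shuttle_switch_iff a_def)
    then have "(a * int (Suc i), 0) \<notin> trapdoors ?L" by (auto simp: tiles_of_kind_def)
    then have sE: "(a * int (Suc i), 0) \<in> ?E"
      using a by (intro closed[of "a * int i"]) (auto simp: abs_mult)
    have "(- a * int (Suc i), 0) \<in> ?E"
    proof (rule explored.unlocked[OF _ _ _ sE s])
      show "(- a * int i, 0) \<in> ?E" using a Suc by auto
      show "adjacent (- a * int i, 0) (- a * int (Suc i), 0)" using a by (auto simp: adjacent_iff)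
      show "(- a * int (Suc i), 0) \<in> tiles ?L" using a Suc.prems by (auto simp: shuttle_tile_iff)
    qed (simp add: shuttle_simps)
    with sE show ?thesis using a by (auto simp: add.commute)
  qed
qed

text \<open>No moves are exhibited: the goal is in the closure, and the origin can serve as home
  cell.\<close>

lemma shuttle_solvable: "solvable (shuttle m K e)"
proof -
  let ?L = "shuttle m K e"
  interpret valid_game ?L by unfold_locales (rule shuttle_valid)
  have "goal ?L \<in> explored ?L (trapdoors ?L) (0, 0)"
    using shuttle_explored[of "m + K" m K e] by (simp add: shuttle_simps)
  then obtain X where "reaches ?L ((14 * num_tiles ?L + 2) * (card (trapdoors ?L) + 1))
      ((0, 0), trapdoors ?L) (goal ?L, X)"
    using explored_reachable[of "trapdoors ?L" "(0, 0)" "goal ?L"]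
    by (auto simp: shuttle_tile_iff shuttle_trapdoor_iff shuttle_switch_iff)
  then show ?thesis
    using solution_reaches unfolding solvable_def shuttle_open shuttle_simps(2) by blast
qed

text \<open>
  Call distance \<open>m + j\<close> from the origin level \<open>j\<close>.  All trapdoors beyond level \<open>J\<close> are still
  open, and the switch of level \<open>J\<close> is on the side given by the sign \<open>e\<close>, that of level
  \<open>J + 1\<close> on the other one.
\<close>

definition shuttle_inv :: "nat \<Rightarrow> nat \<Rightarrow> nat \<Rightarrow> cell \<Rightarrow> cell set \<Rightarrow> bool" where
  "shuttle_inv m K n c X \<longleftrightarrow>
     (\<exists>x J. c = (x, 0) \<and> J \<le> K \<and> \<bar>x\<bar> \<le> int (m + J) \<and>
        (\<forall>z. int (m + J) < \<bar>z\<bar> \<and> \<bar>z\<bar> \<le> int (m + K) \<and> (0 < z) \<noteq> odd (\<bar>z\<bar> - int m) \<longrightarrow> (z, 0) \<in> X) \<and>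
        2 * int m * int J - int m - (if odd J then x else - x) \<le> int n)"

text \<open>While \<open>J\<close> is unchanged, a move shifts \<open>x\<close> by one and raises
  the left side of the final inequality by at most one. \<open>J\<close> can grow only on the side
  of the switch of level \<open>J + 1\<close>, because the trapdoor opposite is still open. There
  the sign flips and the left side falls from \<open>2 * m * J + J\<close> to
  \<open>2 * m * J - J - 1\<close>.\<close>

lemma shuttle_inv_step:
  assumes inv: "shuttle_inv m K n c X"
    and step: "adjacent c c'" "c' \<in> tiles (shuttle m K e)" "X' = land_on (shuttle m K e) c' X" "c' \<notin> X'"
  shows "shuttle_inv m K (Suc n) c' X'"
proof -
  obtain x J where c: "c = (x, 0)" and J: "J \<le> K" "\<bar>x\<bar> \<le> int (m + J)"
    and opn: "\<And>z. int (m + J) < \<bar>z\<bar> \<Longrightarrow> \<bar>z\<bar> \<le> int (m + K) \<Longrightarrow> (0 < z) \<noteq> odd (\<bar>z\<bar> - int m) \<Longrightarrow> (z, 0) \<in> X"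
    and n: "2 * int m * int J - int m - (if odd J then x else - x) \<le> int n"
    using inv unfolding shuttle_inv_def by blast
  obtain x' y' where c': "c' = (x', y')" by (cases c')
  have x': "y' = 0" "\<bar>x'\<bar> \<le> int (m + K)" "x' = x + 1 \<or> x = x' + 1"
    using step(1,2) c c' by (auto simp: adjacent_iff shuttle_tile_iff)
  have X': "(z, 0) \<in> X' \<longleftrightarrow> (z, 0) \<in> X" if "\<bar>z\<bar> \<noteq> \<bar>x'\<bar>" for z
    using step(3) c' that by (auto simp: land_on_def shuttle_simps)
  show ?thesis
  proof (cases "\<bar>x'\<bar> \<le> int (m + J)")
    case True
    then show ?thesis
      unfolding shuttle_inv_def using J n x' opn X' c'
      by (intro exI[of _ x'] exI[of _ J]) (auto split: if_splits)
  next
    case False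
    then have eq: "\<bar>x'\<bar> = int (m + Suc J)" using x' J by auto
    have "(0 < x') = odd (\<bar>x'\<bar> - int m)"
    proof (rule ccontr)
      assume d: "\<not> ?thesis"
      with opn[of x'] False x' have "(x', 0) \<in> X" by simp
      moreover have "(x', 0) \<notin> switches (shuttle m K e)" using d by (simp add: shuttle_switch_iff)
      ultimately show False using step c' x' by (simp add: land_on_def)
    qed
    then have side: "x' = (if odd (Suc J) then int (m + Suc J) else - int (m + Suc J))"
      using eq by (auto split: if_splits)
    have "2 * int m * int (Suc J) - int m - (if odd (Suc J) then x' else - x') \<le> int (Suc n)"
      using n x'(3) unfolding side by (auto simp: algebra_simps split: if_splits)
    moreover have "Suc J \<le> K" using eq x' by auto
    moreover have "(z, 0) \<in> X'" if "int (m + Suc J) < \<bar>z\<bar>" "\<bar>z\<bar> \<le> int (m + K)"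
      "(0 < z) \<noteq> odd (\<bar>z\<bar> - int m)" for z
      using X'[of z] opn[of z] that eq by auto
    ultimately show ?thesis
      unfolding shuttle_inv_def using eq c' x'(1)
      by (intro exI[of _ x'] exI[of _ "Suc J"]) auto
  qed
qed

text \<open>The goal is at the outermost level, which forces \<open>J = K\<close>, and on the side
  away from the last switch, so the signed coordinate in the invariant is
  \<open>- (m + K)\<close>.\<close>

lemma shuttle_solution_length:
  assumes "solution (shuttle m K e) ds" "1 \<le> K"
  shows "2 * m * K \<le> length ds"
proof -
  let ?L = "shuttle m K e"
  obtain X where "make_moves ?L ds ((0, 0), trapdoors ?L) = Some (goal ?L, X)"
    using assms unfolding solution_def shuttle_open shuttle_simps(2) by blast
  then have "shuttle_inv m K (length ds) (goal ?L) X"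
  proof (induction rule: make_moves_induct)
    case (Nil c X)
    then show ?case
      unfolding shuttle_inv_def
      by (intro exI[of _ 0]) (auto simp: shuttle_trapdoor_iff)
  next
    case (Snoc n c X c' X')
    then show ?case by (rule shuttle_inv_step)
  qed
  then obtain J where J: "J \<le> K" "int (m + K) \<le> int (m + J)"
    "2 * int m * int J - int m - (if odd J = odd K then - int (m + K) else int (m + K)) \<le> int (length ds)"
    unfolding shuttle_inv_def shuttle_simps by (auto split: if_splits)
  then have "J = K" by auto
  with J(3) have "int (2 * m * K) \<le> int (length ds)" by simp
  then show ?thesis by (simp only: of_nat_le_iff)
qed

lemma quadratic_lower_bound:
  assumes "n \<ge> 20"
  shows "\<exists>L. valid_level L \<and> num_tiles L = n \<and> solvable L \<and>
         (\<forall>ds. solution L ds \<longrightarrow> real (length ds) \<ge> 1 / 20 * real n ^ 2)"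
proof -
  \<comment> \<open>The line takes \<open>2 * M + 1\<close> tiles, the largest odd number up to
    \<open>n\<close>. Halving \<open>M\<close> makes \<open>m * K\<close> as large as
    possible.\<close>
  define M where "M = (n - 1) div 2"
  define K where "K = M div 2"
  define m where "m = M - K"
  define L where "L = shuttle m K (even n)"
  have "num_tiles L = n"
    using assms unfolding L_def shuttle_num_tiles m_def K_def M_def
    by (cases "even n") (auto elim!: evenE oddE)
  moreover have "real (length ds) \<ge> 1 / 20 * real n ^ 2" if "solution L ds" for ds
  proof -
    \<comment> \<open>\<open>K\<close> is at least \<open>(n - 4) / 4\<close>, which gives
      \<open>n \<le> 5 * K\<close> from \<open>n \<ge> 20\<close>. The resulting factor 2/25 exceeds
      1/20.\<close>
    have K: "n \<le> 5 * K" "K \<le> m" "1 \<le> K" using assms unfolding m_def K_def M_def by linarith+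
    have "n ^ 2 \<le> (5 * K) ^ 2" using K by (intro power_mono) auto
    also have "\<dots> = 25 * (K * K)" by (simp add: power2_eq_square)
    also have "\<dots> \<le> 25 * (m * K)" using K by (intro mult_le_mono) auto
    finally have "real (n ^ 2) \<le> real (25 * (m * K))" by (simp only: of_nat_le_iff)
    moreover have "real (2 * (m * K)) \<le> real (length ds)"
      using shuttle_solution_length[OF that[unfolded L_def] K(3)] by (simp only: of_nat_le_iff mult.assoc)
    ultimately show ?thesis by simp
  qed
  ultimately show ?thesis
    using shuttle_valid shuttle_solvable unfolding L_def by blast
qed

section \<open>Functions computable in polynomial time\<close>

lemma poly_nat_mono: "m \<le> n \<Longrightarrow> poly (q :: nat poly) m \<le> poly q n"
  by (induction q) (auto intro!: add_mono mult_mono)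

definition poly_bounded :: "(tree \<Rightarrow> nat) \<Rightarrow> bool" where
  "poly_bounded b \<longleftrightarrow> (\<exists>q. \<forall>x. b x \<le> poly q (size x))"

lemma poly_bounded_mono: "poly_bounded b \<Longrightarrow> (\<And>x. b' x \<le> b x) \<Longrightarrow> poly_bounded b'"
  unfolding poly_bounded_def by (meson le_trans)

lemma poly_bounded_const: "poly_bounded (\<lambda>x. c)"
  unfolding poly_bounded_def by (intro exI[of _ "[:c:]"]) simp

lemma poly_bounded_size: "poly_bounded size"
  unfolding poly_bounded_def by (intro exI[of _ "[:0, 1:]"]) simp

lemma poly_bounded_add: "poly_bounded a \<Longrightarrow> poly_bounded b \<Longrightarrow> poly_bounded (\<lambda>x. a x + b x)"
  unfolding poly_bounded_def by (metis add_mono poly_add)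

lemma poly_bounded_mult: "poly_bounded a \<Longrightarrow> poly_bounded b \<Longrightarrow> poly_bounded (\<lambda>x. a x * b x)"
  unfolding poly_bounded_def by (metis mult_le_mono poly_mult)

lemma poly_bounded_poly: "poly_bounded b \<Longrightarrow> poly_bounded (\<lambda>x. poly q (b x))"
  unfolding poly_bounded_def by (metis poly_nat_mono poly_pcompose)

lemma poly_bounded_comp:
  assumes "poly_bounded b" "poly_bounded (\<lambda>x. size (f x))"
  shows "poly_bounded (\<lambda>x. b (f x))"
proof -
  obtain q where "\<And>x. b x \<le> poly q (size x)" using assms(1) unfolding poly_bounded_def by blast
  then show ?thesis by (intro poly_bounded_mono[OF poly_bounded_poly[OF assms(2), of q]])
qed

lemmas poly_bounded_intros =
  poly_bounded_const poly_bounded_size poly_bounded_add poly_bounded_mult poly_bounded_poly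

text \<open>
  The input and the output are in variable \<open>v\<close>, and the variables below \<open>v\<close> are preserved.
  The variables above \<open>v\<close> may initially hold anything, so that programs can be composed.
\<close>

definition computes :: "nat \<Rightarrow> program \<Rightarrow> (tree \<Rightarrow> tree) \<Rightarrow> (tree \<Rightarrow> nat) \<Rightarrow> bool" where
  "computes v p f T \<longleftrightarrow> (\<forall>s. \<exists>t s'. exec p s t s' \<and> s' v = f (s v) \<and> (\<forall>i<v. s' i = s i) \<and> t \<le> T (s v))"

lemma computesE:
  assumes "computes v p f T"
  obtains t s' where "exec p s t s'" "s' v = f (s v)" "\<And>i. i < v \<Longrightarrow> s' i = s i" "t \<le> T (s v)"
  using assms unfolding computes_def by metis

text \<open>The size of the result is bounded separately because time does not bound it: with shared
  nodes, repeatedly replacing a tree by \<open>Node\<close> of itself with itself doubles its size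
  at constant cost. One \<open>T\<close> serves all \<open>v\<close>, so that programs may be placed
  at any variable.\<close>

definition ptime :: "(tree \<Rightarrow> tree) \<Rightarrow> bool" where
  "ptime f \<longleftrightarrow> poly_bounded (\<lambda>x. size (f x)) \<and>
     (\<exists>T. poly_bounded T \<and> (\<forall>v. \<exists>p. computes v p f T))"

lemma ptimeE:
  assumes "ptime f"
  obtains T p where "poly_bounded (\<lambda>x. size (f x))" "poly_bounded T" "\<And>v. computes v (p v) f T"
  using assms unfolding ptime_def by metis

lemma ptimeI:
  assumes "poly_bounded (\<lambda>x. size (f x))" "poly_bounded T"
    and "\<And>v s. \<exists>t s'. exec (p v) s t s' \<and> s' v = f (s v) \<and> (\<forall>i<v. s' i = s i) \<and> t \<le> T (s v)"
  shows "ptime f"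
  using assms unfolding ptime_def computes_def by blast

lemma ptime_id: "ptime (\<lambda>x. x)"
proof (rule ptimeI[where p = "\<lambda>v. SKIP"])
  show "\<exists>t s'. exec SKIP s t s' \<and> s' v = s v \<and> (\<forall>i<v. s' i = s i) \<and> t \<le> 1" for v and s :: store
    using exec.Skip by blast
qed (rule poly_bounded_intros)+

lemma ptime_comp:
  assumes "ptime f" "ptime g"
  shows "ptime (\<lambda>x. f (g x))"
proof -
  obtain Tf pf where f: "poly_bounded (\<lambda>x. size (f x))" "poly_bounded Tf" "\<And>v. computes v (pf v) f Tf"
    using assms(1) by (rule ptimeE) blast
  obtain Tg pg where g: "poly_bounded (\<lambda>x. size (g x))" "poly_bounded Tg" "\<And>v. computes v (pg v) g Tg"
    using assms(2) by (rule ptimeE) blast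
  show ?thesis
  proof (rule ptimeI[where p = "\<lambda>v. SEQ (pg v) (pf v)"])
    show "poly_bounded (\<lambda>x. size (f (g x)))" by (rule poly_bounded_comp[OF f(1) g(1)])
    show "poly_bounded (\<lambda>x. 1 + Tg x + Tf (g x))"
      by (intro poly_bounded_intros g poly_bounded_comp[OF f(2)])
  next
    fix v s
    obtain t s' where 1: "exec (pg v) s t s'" "s' v = g (s v)" "\<And>i. i < v \<Longrightarrow> s' i = s i" "t \<le> Tg (s v)"
      by (rule computesE[OF g(3)[of "v"], where s = "s"]) blast
    obtain u s'' where 2: "exec (pf v) s' u s''" "s'' v = f (s' v)" "\<And>i. i < v \<Longrightarrow> s'' i = s' i" "u \<le> Tf (s' v)"
      by (rule computesE[OF f(3)[of "v"], where s = "s'"]) blast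
    show "\<exists>t s'. exec (SEQ (pg v) (pf v)) s t s' \<and> s' v = f (g (s v)) \<and> (\<forall>i<v. s' i = s i) \<and>
        t \<le> 1 + Tg (s v) + Tf (g (s v))"
      using exec.Seq[OF 1(1) 2(1)] 1 2 by (intro exI[of _ "1 + t + u"] exI[of _ s'']) auto
  qed
qed

lemma ptime_Leaf: "ptime (\<lambda>x. Leaf)"
proof (rule ptimeI[where p = "\<lambda>v. ASSIGN v LeafE"])
  show "\<exists>t s'. exec (ASSIGN v LeafE) s t s' \<and> s' v = Leaf \<and> (\<forall>i<v. s' i = s i) \<and> t \<le> 2" for v s
    by (intro exI conjI, rule exec.Assign) auto
qed (rule poly_bounded_intros)+

lemma size_left: "size (left x) \<le> size x" and size_right: "size (right x) \<le> size x"
  by (cases x; simp)+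

lemma ptime_left: "ptime f \<Longrightarrow> ptime (\<lambda>x. left (f x))"
proof (rule ptime_comp[of left], rule ptimeI[where p = "\<lambda>v. ASSIGN v (LeftE (Var v))"])
  show "\<exists>t s'. exec (ASSIGN v (LeftE (Var v))) s t s' \<and> s' v = left (s v) \<and> (\<forall>i<v. s' i = s i) \<and> t \<le> 3" for v s
    by (intro exI conjI, rule exec.Assign) auto
qed (rule poly_bounded_mono[OF poly_bounded_size size_left] poly_bounded_const | assumption)+

lemma ptime_right: "ptime f \<Longrightarrow> ptime (\<lambda>x. right (f x))"
proof (rule ptime_comp[of right], rule ptimeI[where p = "\<lambda>v. ASSIGN v (RightE (Var v))"])
  show "\<exists>t s'. exec (ASSIGN v (RightE (Var v))) s t s' \<and> s' v = right (s v) \<and> (\<forall>i<v. s' i = s i) \<and> t \<le> 3" for v s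
    by (intro exI conjI, rule exec.Assign) auto
qed (rule poly_bounded_mono[OF poly_bounded_size size_right] poly_bounded_const | assumption)+

lemma exec_assign: "t = 1 + expr_cost a \<Longrightarrow> s' = s(x := expr_val a s) \<Longrightarrow> exec (ASSIGN x a) s t s'"
  using exec.Assign by simp

lemma ptime_Node:
  assumes "ptime f" "ptime g"
  shows "ptime (\<lambda>x. Node (f x) (g x))"
proof -
  obtain Tf pf where f: "poly_bounded (\<lambda>x. size (f x))" "poly_bounded Tf" "\<And>v. computes v (pf v) f Tf"
    using assms(1) by (rule ptimeE) blast
  obtain Tg pg where g: "poly_bounded (\<lambda>x. size (g x))" "poly_bounded Tg" "\<And>v. computes v (pg v) g Tg"
    using assms(2) by (rule ptimeE) blast
  show ?thesis
  proof (rule ptimeI[where p = "\<lambda>v. SEQ (ASSIGN (v + 1) (Var v)) (SEQ (pf (v + 1))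
      (SEQ (ASSIGN (v + 2) (Var v)) (SEQ (pg (v + 2)) (ASSIGN v (NodeE (Var (v + 1)) (Var (v + 2)))))))"])
    show "poly_bounded (\<lambda>x. size (Node (f x) (g x)))"
      by (rule poly_bounded_mono[of "\<lambda>x. 1 + size (f x) + size (g x)"])
        (intro poly_bounded_intros f g, simp)
    show "poly_bounded (\<lambda>x. 12 + Tf x + Tg x)"
      by (intro poly_bounded_intros f g)
  next
    fix v and s :: store
    let ?s1 = "s(v + 1 := s v)"
    obtain t s2 where 1: "exec (pf (v + 1)) ?s1 t s2" "s2 (v + 1) = f (?s1 (v + 1))"
      "\<And>i. i < v + 1 \<Longrightarrow> s2 i = ?s1 i" "t \<le> Tf (?s1 (v + 1))"
      by (rule computesE[OF f(3)[of "v + 1"], where s = "?s1"]) blast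
    let ?s3 = "s2(v + 2 := s2 v)"
    obtain u s4 where 2: "exec (pg (v + 2)) ?s3 u s4" "s4 (v + 2) = g (?s3 (v + 2))"
      "\<And>i. i < v + 2 \<Longrightarrow> s4 i = ?s3 i" "u \<le> Tg (?s3 (v + 2))"
      by (rule computesE[OF g(3)[of "v + 2"], where s = "?s3"]) blast
    let ?s5 = "s4(v := Node (s4 (v + 1)) (s4 (v + 2)))"
    have "exec (SEQ (ASSIGN (v + 1) (Var v)) (SEQ (pf (v + 1))
      (SEQ (ASSIGN (v + 2) (Var v)) (SEQ (pg (v + 2)) (ASSIGN v (NodeE (Var (v + 1)) (Var (v + 2))))))))
      s (1 + 2 + (1 + t + (1 + 2 + (1 + u + 4)))) ?s5"
      by (intro exec.Seq[OF exec_assign exec.Seq[OF 1(1) exec.Seq[OF exec_assign exec.Seq[OF 2(1) exec_assign]]]]) auto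
    then show "\<exists>t s'. exec (SEQ (ASSIGN (v + 1) (Var v)) (SEQ (pf (v + 1))
      (SEQ (ASSIGN (v + 2) (Var v)) (SEQ (pg (v + 2)) (ASSIGN v (NodeE (Var (v + 1)) (Var (v + 2))))))))
      s t s' \<and> s' v = Node (f (s v)) (g (s v)) \<and> (\<forall>i<v. s' i = s i) \<and> t \<le> 12 + Tf (s v) + Tg (s v)"
      using 1 2 by (intro exI conjI) (assumption, auto)
  qed
qed

section \<open>Conditionals and list processing\<close>

definition ptest :: "(tree \<Rightarrow> bool) \<Rightarrow> bool" where
  "ptest P \<longleftrightarrow> ptime (\<lambda>x. enc_bool (P x))"

lemma enc_bool_eq_Leaf [simp]: "enc_bool b = Leaf \<longleftrightarrow> \<not> b"
  by (simp add: enc_bool_def)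

lemma ptime_if:
  assumes "ptest P" "ptime f" "ptime g"
  shows "ptime (\<lambda>x. if P x then f x else g x)"
proof -
  obtain Tc pc where c: "poly_bounded Tc" "\<And>v. computes v (pc v) (\<lambda>x. enc_bool (P x)) Tc"
    using assms(1) unfolding ptest_def by (rule ptimeE) blast
  obtain Tf pf where f: "poly_bounded (\<lambda>x. size (f x))" "poly_bounded Tf" "\<And>v. computes v (pf v) f Tf"
    using assms(2) by (rule ptimeE) blast
  obtain Tg pg where g: "poly_bounded (\<lambda>x. size (g x))" "poly_bounded Tg" "\<And>v. computes v (pg v) g Tg"
    using assms(3) by (rule ptimeE) blast
  show ?thesis
  proof (rule ptimeI[where p = "\<lambda>v. SEQ (ASSIGN (v + 1) (Var v)) (SEQ (pc (v + 1)) (IF (Var (v + 1)) (pf v) (pg v)))"])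
    show "poly_bounded (\<lambda>x. size (if P x then f x else g x))"
      by (rule poly_bounded_mono[OF poly_bounded_add[OF f(1) g(1)]]) auto
    show "poly_bounded (\<lambda>x. 6 + Tc x + Tf x + Tg x)" by (intro poly_bounded_intros c f g)
  next
    fix v and s :: store
    let ?s1 = "s(v + 1 := s v)"
    let ?p = "SEQ (ASSIGN (v + 1) (Var v)) (SEQ (pc (v + 1)) (IF (Var (v + 1)) (pf v) (pg v)))"
    obtain t s2 where 1: "exec (pc (v + 1)) ?s1 t s2" "s2 (v + 1) = enc_bool (P (?s1 (v + 1)))"
      "\<And>i. i < v + 1 \<Longrightarrow> s2 i = ?s1 i" "t \<le> Tc (?s1 (v + 1))"
      by (rule computesE[OF c(2)[of "v + 1"], where s = "?s1"]) blast
    have seq: "exec ?p s (1 + 2 + (1 + t + u)) s3" if "exec (IF (Var (v + 1)) (pf v) (pg v)) s2 u s3" for u s3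
      using that by (intro exec.Seq[OF exec_assign exec.Seq[OF 1(1)]]) auto
    show "\<exists>t s'. exec ?p s t s' \<and> s' v = (if P (s v) then f (s v) else g (s v)) \<and>
        (\<forall>i<v. s' i = s i) \<and> t \<le> 6 + Tc (s v) + Tf (s v) + Tg (s v)"
    proof (cases "P (s v)")
      case True
      obtain u s3 where 2: "exec (pf v) s2 u s3" "s3 v = f (s2 v)"
        "\<And>i. i < v \<Longrightarrow> s3 i = s2 i" "u \<le> Tf (s2 v)"
        by (rule computesE[OF f(3)[of "v"], where s = "s2"]) blast
      have "exec (IF (Var (v + 1)) (pf v) (pg v)) s2 (1 + expr_cost (Var (v + 1)) + u) s3"
        using 1 True by (intro exec.IfTrue 2) auto
      from seq[OF this] show ?thesis using 1 2 True by (intro exI conjI) (assumption, auto)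
    next
      case False
      obtain u s3 where 2: "exec (pg v) s2 u s3" "s3 v = g (s2 v)"
        "\<And>i. i < v \<Longrightarrow> s3 i = s2 i" "u \<le> Tg (s2 v)"
        by (rule computesE[OF g(3)[of "v"], where s = "s2"]) blast
      have "exec (IF (Var (v + 1)) (pf v) (pg v)) s2 (1 + expr_cost (Var (v + 1)) + u) s3"
        using 1 False by (intro exec.IfFalse 2) auto
      from seq[OF this] show ?thesis using 1 2 False by (intro exI conjI) (assumption, auto)
    qed
  qed
qed

text \<open>Every tree is read as a list along its right spine, so list functions are total even on
  trees that encode nothing.\<close>

fun telems :: "tree \<Rightarrow> tree list" where
  "telems Leaf = []"
| "telems (Node e l) = e # telems l"

lemma telems_enc_list [simp]: "telems (enc_list es) = es"
  by (induction es) auto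

lemma enc_list_telems [simp]: "enc_list (telems l) = l"
  by (induction l) auto

lemma length_telems: "length (telems l) \<le> size l"
  by (induction l) auto

lemma size_telems: "e \<in> set (telems l) \<Longrightarrow> size e \<le> size l"
  by (induction l) auto

text \<open>Variable \<open>v\<close> keeps the parameter, \<open>v + 1\<close> the remaining list
  and \<open>v + 2\<close> the accumulator; \<open>p\<close> works from \<open>v + 3\<close>
  upwards. Each round costs 17 units besides the run of \<open>p\<close>, and the last test of the
  loop costs 2.\<close>

lemma exec_fold:
  assumes G: "computes (v + 3) p (\<lambda>z. G (left (left z)) (right (left z)) (right z)) T"
    and W: "\<And>i. i < length (telems l) \<Longrightarrow>
      T (Node (Node x (telems l ! i)) (foldl (\<lambda>acc e. G x e acc) acc (take i (telems l)))) \<le> W"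
    and s: "s v = x" "s (v + 1) = l" "s (v + 2) = acc"
  shows "\<exists>t s'. exec (WHILE (Var (v + 1))
      (SEQ (ASSIGN (v + 3) (NodeE (NodeE (Var v) (LeftE (Var (v + 1)))) (Var (v + 2))))
      (SEQ p (SEQ (ASSIGN (v + 2) (Var (v + 3))) (ASSIGN (v + 1) (RightE (Var (v + 1)))))))) s t s' \<and>
    s' (v + 2) = foldl (\<lambda>acc e. G x e acc) acc (telems l) \<and> (\<forall>i<v. s' i = s i) \<and>
    t \<le> 2 + length (telems l) * (17 + W)" (is "\<exists>t s'. exec (WHILE ?b ?body) s t s' \<and> _")
  using W s
proof (induction l arbitrary: acc s)
  case Leaf
  have "exec (WHILE ?b ?body) s (1 + expr_cost ?b) s" using Leaf by (intro exec.WhileFalse) simp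
  then show ?case using Leaf by (intro exI conjI) (assumption, auto)
next
  case (Node e l)
  let ?s1 = "s(v + 3 := Node (Node x e) acc)"
  obtain t s2 where 1: "exec p ?s1 t s2"
    "s2 (v + 3) = G (left (left (?s1 (v + 3)))) (right (left (?s1 (v + 3)))) (right (?s1 (v + 3)))"
    "\<And>i. i < v + 3 \<Longrightarrow> s2 i = ?s1 i" "t \<le> T (?s1 (v + 3))"
    by (rule computesE[OF G, where s = "?s1"]) blast
  let ?s3 = "s2(v + 2 := s2 (v + 3), v + 1 := l)"
  have tW: "t \<le> W" using 1(4) Node.prems(1)[of 0] by simp
  have body: "exec ?body s (1 + 7 + (1 + t + (1 + 2 + 3))) ?s3"
    using 1 Node.prems
    by (intro exec.Seq[OF exec_assign exec.Seq[OF 1(1) exec.Seq[OF exec_assign exec_assign]]]) auto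
  have "\<exists>t s'. exec (WHILE ?b ?body) ?s3 t s' \<and>
    s' (v + 2) = foldl (\<lambda>acc e. G x e acc) (G x e acc) (telems l) \<and> (\<forall>i<v. s' i = ?s3 i) \<and>
    t \<le> 2 + length (telems l) * (17 + W)"
  proof (rule Node.IH(2))
    show "T (Node (Node x (telems l ! i)) (foldl (\<lambda>acc e. G x e acc) (G x e acc) (take i (telems l)))) \<le> W"
      if "i < length (telems l)" for i
      using Node.prems(1)[of "Suc i"] that by simp
  qed (use 1 Node.prems in auto)
  then obtain u s4 where 2: "exec (WHILE ?b ?body) ?s3 u s4"
    "s4 (v + 2) = foldl (\<lambda>acc e. G x e acc) (G x e acc) (telems l)" "\<And>i. i < v \<Longrightarrow> s4 i = ?s3 i"
    "u \<le> 2 + length (telems l) * (17 + W)" by blast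
  have "exec (WHILE ?b ?body) s (1 + expr_cost ?b + (1 + 7 + (1 + t + (1 + 2 + 3))) + u) s4"
    using Node.prems by (intro exec.WhileTrue[OF _ body 2(1)]) simp
  then show ?case using 1 2 tW by (intro exI conjI) (assumption, auto)
qed

text \<open>\<open>B\<close> must bound every intermediate accumulator: iterating a polynomial-time
  step may otherwise produce results of exponential size.\<close>

lemma ptime_fold:
  assumes G: "ptime (\<lambda>z. G (left (left z)) (right (left z)) (right z))"
    and L: "ptime L" and A: "ptime A"
    and B: "poly_bounded B" "\<And>x i. size (foldl (\<lambda>acc e. G x e acc) (A x) (take i (telems (L x)))) \<le> B x"
  shows "ptime (\<lambda>x. foldl (\<lambda>acc e. G x e acc) (A x) (telems (L x)))"
proof -
  obtain TG pG where g: "poly_bounded TG"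
    "\<And>v. computes v (pG v) (\<lambda>z. G (left (left z)) (right (left z)) (right z)) TG"
    using G by (rule ptimeE) blast
  obtain TL pL where l: "poly_bounded (\<lambda>x. size (L x))" "poly_bounded TL" "\<And>v. computes v (pL v) L TL"
    using L by (rule ptimeE) blast
  obtain TA pA where a: "poly_bounded TA" "\<And>v. computes v (pA v) A TA"
    using A by (rule ptimeE) blast
  obtain q where q: "\<And>z. TG z \<le> poly q (size z)" using g(1) unfolding poly_bounded_def by blast
  \<comment> \<open>A single step receives \<open>Node (Node x e) acc\<close>, with \<open>e\<close>
    no larger than \<open>L x\<close> and \<open>acc\<close> no larger than
    \<open>B x\<close>.\<close>
  define W where "W x = poly q (2 + size x + size (L x) + B x)" for x
  have W: "TG (Node (Node x (telems (L x) ! i)) (foldl (\<lambda>acc e. G x e acc) (A x) (take i (telems (L x))))) \<le> W x"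
    if "i < length (telems (L x))" for x i
    unfolding W_def using that B(2)[of x i] size_telems[of "telems (L x) ! i" "L x"]
    by (intro order_trans[OF q] poly_nat_mono) simp
  define loop where "loop v = WHILE (Var (v + 1))
      (SEQ (ASSIGN (v + 3) (NodeE (NodeE (Var v) (LeftE (Var (v + 1)))) (Var (v + 2))))
      (SEQ (pG (v + 3)) (SEQ (ASSIGN (v + 2) (Var (v + 3))) (ASSIGN (v + 1) (RightE (Var (v + 1)))))))" for v
  show ?thesis
  proof (rule ptimeI[where p = "\<lambda>v. SEQ (ASSIGN (v + 1) (Var v)) (SEQ (pL (v + 1))
      (SEQ (ASSIGN (v + 2) (Var v)) (SEQ (pA (v + 2)) (SEQ (loop v) (ASSIGN v (Var (v + 2)))))))"])
    show "poly_bounded (\<lambda>x. size (foldl (\<lambda>acc e. G x e acc) (A x) (telems (L x))))"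
      by (rule poly_bounded_mono[OF B(1)]) (metis B(2) order_refl take_all)
    show "poly_bounded (\<lambda>x. 13 + TL x + TA x + size (L x) * (17 + W x))"
      unfolding W_def by (intro poly_bounded_intros l a B)
  next
    fix v and s :: store
    let ?p = "SEQ (ASSIGN (v + 1) (Var v)) (SEQ (pL (v + 1))
      (SEQ (ASSIGN (v + 2) (Var v)) (SEQ (pA (v + 2)) (SEQ (loop v) (ASSIGN v (Var (v + 2)))))))"
    let ?x = "s v"
    let ?s1 = "s(v + 1 := s v)"
    obtain t s2 where 1: "exec (pL (v + 1)) ?s1 t s2" "s2 (v + 1) = L (?s1 (v + 1))"
      "\<And>i. i < v + 1 \<Longrightarrow> s2 i = ?s1 i" "t \<le> TL (?s1 (v + 1))"
      by (rule computesE[OF l(3)[of "v + 1"], where s = "?s1"]) blast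
    let ?s3 = "s2(v + 2 := s2 v)"
    obtain u s4 where 2: "exec (pA (v + 2)) ?s3 u s4" "s4 (v + 2) = A (?s3 (v + 2))"
      "\<And>i. i < v + 2 \<Longrightarrow> s4 i = ?s3 i" "u \<le> TA (?s3 (v + 2))"
      by (rule computesE[OF a(2)[of "v + 2"], where s = "?s3"]) blast
    have s4: "s4 v = ?x" "s4 (v + 1) = L ?x" "s4 (v + 2) = A ?x" using 1 2 by auto
    from exec_fold[OF g(2) W s4] obtain w s5 where 3: "exec (loop v) s4 w s5"
      "s5 (v + 2) = foldl (\<lambda>acc e. G ?x e acc) (A ?x) (telems (L ?x))"
      "\<And>i. i < v \<Longrightarrow> s5 i = s4 i" "w \<le> 2 + length (telems (L ?x)) * (17 + W ?x)"
      unfolding loop_def by blast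
    have "exec ?p s (1 + 2 + (1 + t + (1 + 2 + (1 + u + (1 + w + 2))))) (s5(v := s5 (v + 2)))"
      by (intro exec.Seq[OF exec_assign exec.Seq[OF 1(1) exec.Seq[OF exec_assign
          exec.Seq[OF 2(1) exec.Seq[OF 3(1) exec_assign]]]]]) auto
    moreover have "w \<le> 2 + size (L ?x) * (17 + W ?x)"
      using 3(4) mult_le_mono1[OF length_telems] by (meson add_le_mono order_refl order_trans)
    ultimately show "\<exists>t s'. exec ?p s t s' \<and> s' v = foldl (\<lambda>acc e. G ?x e acc) (A ?x) (telems (L ?x)) \<and>
        (\<forall>i<v. s' i = s i) \<and> t \<le> 13 + TL ?x + TA ?x + size (L ?x) * (17 + W ?x)"
      using 1 2 3(2,3) by (intro exI conjI) (assumption, auto)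
  qed
qed

lemma ptest_comp: "ptest P \<Longrightarrow> ptime f \<Longrightarrow> ptest (\<lambda>x. P (f x))"
  unfolding ptest_def by (rule ptime_comp)

lemma ptest_Leaf: "ptime f \<Longrightarrow> ptest (\<lambda>x. f x = Leaf)"
proof (rule ptest_comp[of "\<lambda>x. x = Leaf"])
  show "ptest (\<lambda>x. x = Leaf)"
    unfolding ptest_def
  proof (rule ptimeI[where p = "\<lambda>v. IF (Var v) (ASSIGN v LeafE) (ASSIGN v (NodeE LeafE LeafE))"])
    show "poly_bounded (\<lambda>x. size (enc_bool (x = Leaf)))"
      by (rule poly_bounded_mono[OF poly_bounded_const[of 1]]) (simp add: enc_bool_def)
  next
    fix v and s :: store
    show "\<exists>t s'. exec (IF (Var v) (ASSIGN v LeafE) (ASSIGN v (NodeE LeafE LeafE))) s t s' \<and>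
        s' v = enc_bool (s v = Leaf) \<and> (\<forall>i<v. s' i = s i) \<and> t \<le> 6"
    proof (cases "s v = Leaf")
      case True
      have "exec (IF (Var v) (ASSIGN v LeafE) (ASSIGN v (NodeE LeafE LeafE))) s
          (1 + expr_cost (Var v) + 4) (s(v := Node Leaf Leaf))"
        using True by (intro exec.IfFalse exec_assign) auto
      then show ?thesis using True by (intro exI conjI) (assumption, auto simp: enc_bool_def)
    next
      case False
      have "exec (IF (Var v) (ASSIGN v LeafE) (ASSIGN v (NodeE LeafE LeafE))) s
          (1 + expr_cost (Var v) + 2) (s(v := Leaf))"
        using False by (intro exec.IfTrue exec_assign) auto
      then show ?thesis using False by (intro exI conjI) (assumption, auto simp: enc_bool_def)
    qed
  qed (rule poly_bounded_const)
qed

lemma ptest_Leaf': "ptime f \<Longrightarrow> ptest (\<lambda>x. Leaf = f x)"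
  unfolding eq_commute[of Leaf] by (rule ptest_Leaf)

lemma ptest_conj: "ptest P \<Longrightarrow> ptest Q \<Longrightarrow> ptest (\<lambda>x. P x \<and> Q x)"
proof -
  assume "ptest P" "ptest Q"
  then have "ptime (\<lambda>x. if P x then enc_bool (Q x) else Leaf)"
    by (intro ptime_if ptime_Leaf) (auto simp: ptest_def)
  also have "(\<lambda>x. if P x then enc_bool (Q x) else Leaf) = (\<lambda>x. enc_bool (P x \<and> Q x))"
    by (auto simp: enc_bool_def)
  finally show ?thesis unfolding ptest_def .
qed

lemma ptest_not: "ptest P \<Longrightarrow> ptest (\<lambda>x. \<not> P x)"
proof -
  assume "ptest P"
  then have "ptime (\<lambda>x. if P x then Leaf else Node Leaf Leaf)"
    by (intro ptime_if ptime_Leaf ptime_Node)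
  also have "(\<lambda>x. if P x then Leaf else Node Leaf Leaf) = (\<lambda>x. enc_bool (\<not> P x))"
    by (auto simp: enc_bool_def)
  finally show ?thesis unfolding ptest_def .
qed

lemma ptest_disj: "ptest P \<Longrightarrow> ptest Q \<Longrightarrow> ptest (\<lambda>x. P x \<or> Q x)"
  using ptest_not[OF ptest_conj[OF ptest_not ptest_not], of P Q] by simp

lemma ptest_if:
  assumes "ptest P" "ptest Q" "ptest R"
  shows "ptest (\<lambda>x. if P x then Q x else R x)"
  using ptime_if[OF assms(1) assms(2,3)[unfolded ptest_def]]
  unfolding ptest_def if_distrib[of enc_bool] .

lemma ptest_iff:
  assumes "ptest P" "ptest Q"
  shows "ptest (\<lambda>x. P x = Q x)"
proof -
  have "(\<lambda>x. P x = Q x) = (\<lambda>x. if P x then Q x else \<not> Q x)" by auto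
  then show ?thesis using ptest_if[OF assms ptest_not[OF assms(2)]] by simp
qed

lemmas ptime_intros =
  ptime_id ptime_Leaf ptime_Node ptime_left ptime_right ptime_if
  ptest_Leaf ptest_Leaf' ptest_conj ptest_disj ptest_not ptest_iff ptest_if

lemma size_enc_list_filter: "size (enc_list (filter P es)) \<le> size (enc_list es)"
  by (induction es) auto

lemma size_enc_list_append: "size (enc_list (es @ es')) = size (enc_list es) + size (enc_list es')"
  by (induction es) auto

lemma size_enc_list_rev: "size (enc_list (rev es)) = size (enc_list es)"
  by (induction es) (auto simp: size_enc_list_append)

lemma size_enc_list_take: "size (enc_list (take i es)) \<le> size (enc_list es)"
  by (metis append_take_drop_id le_add1 size_enc_list_append)

text \<open>The reversal appears because the fold pushes each element onto the front of its
  result.\<close>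

lemma ptime_filter:
  assumes P: "ptest (\<lambda>z. P (left z) (right z))" and L: "ptime L"
  shows "ptime (\<lambda>x. enc_list (rev (filter (P x) (telems (L x)))))"
proof -
  define G where "G x e acc = (if P x e then Node e acc else acc)" for x e acc
  have fold: "foldl (\<lambda>acc e. G x e acc) acc es = enc_list (rev (filter (P x) es) @ telems acc)" for x es acc
    by (induction es arbitrary: acc) (auto simp: G_def)
  have "ptime (\<lambda>z. G (left (left z)) (right (left z)) (right z))"
    unfolding G_def using ptest_comp[OF P ptime_left[OF ptime_id]] by (intro ptime_intros)
  then have "ptime (\<lambda>x. foldl (\<lambda>acc e. G x e acc) Leaf (telems (L x)))"
  proof (rule ptime_fold[OF _ L ptime_Leaf])
    show "poly_bounded (\<lambda>x. size (L x))" using L by (rule ptimeE) blast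
    show "size (foldl (\<lambda>acc e. G x e acc) Leaf (take i (telems (L x)))) \<le> size (L x)" for x i
    proof -
      have "size (enc_list (filter (P x) (take i (telems (L x))))) \<le> size (enc_list (telems (L x)))"
        using size_enc_list_filter size_enc_list_take by (rule order_trans)
      then show ?thesis by (simp add: fold size_enc_list_rev)
    qed
  qed
  then show ?thesis by (simp add: fold)
qed

lemma ptest_ex:
  assumes "ptest (\<lambda>z. P (left z) (right z))" "ptime L"
  shows "ptest (\<lambda>x. \<exists>e\<in>set (telems (L x)). P x e)"
proof -
  have "enc_list (rev (filter Q es)) = Leaf \<longleftrightarrow> \<not> (\<exists>e\<in>set es. Q e)" for Q es
    using empty_filter_conv[of Q es] by (cases "rev (filter Q es)") auto
  then show ?thesis
    using ptest_not[OF ptest_Leaf[OF ptime_filter[OF assms]]] by simp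
qed

text \<open>A fold that ignores the elements, so that the list serves as a unary counter.\<close>

lemma ptime_iterate:
  assumes F: "ptime (\<lambda>z. F (left z) (right z))" and L: "ptime L" and A: "ptime A"
    and B: "poly_bounded B" "\<And>x i. size ((F x ^^ i) (A x)) \<le> B x"
  shows "ptime (\<lambda>x. (F x ^^ length (telems (L x))) (A x))"
proof -
  have fold: "foldl (\<lambda>acc e. F x acc) acc es = (F x ^^ length es) acc" for x acc and es :: "tree list"
    by (induction es arbitrary: acc) (auto simp: funpow_swap1)
  have "ptime (\<lambda>z. F (left (left z)) (right z))"
    using ptime_comp[OF F ptime_Node[OF ptime_left[OF ptime_left[OF ptime_id]] ptime_right[OF ptime_id]]]
    by simp
  from ptime_fold[OF this L A B(1)] show ?thesis using B(2) by (simp add: fold)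
qed

section \<open>Arithmetic on encoded cells\<close>

text \<open>
  Compares the binary numbers \<open>b\<close> and \<open>a + c\<close> digit by digit, where the carry \<open>c\<close> is \<open>Leaf\<close>
  for 0.  The accumulator holds the carry and the remaining digits of \<open>b\<close>; it is \<open>Leaf\<close> if a
  difference has been found.
\<close>

definition sum_step :: "tree \<Rightarrow> tree \<Rightarrow> tree" where
  "sum_step e acc =
     (if acc = Leaf \<or> right acc = Leaf then Leaf
      else if (left (right acc) \<noteq> Leaf) = ((e \<noteq> Leaf) \<noteq> (left acc \<noteq> Leaf))
      then Node (if e = Leaf then Leaf else left acc) (right (right acc)) else Leaf)"

text \<open>Once \<open>a\<close> is used up, the rest of \<open>b\<close> must be empty if there is
  no carry, and the single digit one otherwise.\<close>

definition sum_end :: "tree \<Rightarrow> bool" where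
  "sum_end acc \<longleftrightarrow> acc \<noteq> Leaf \<and>
     (if left acc = Leaf then right acc = Leaf
      else right acc \<noteq> Leaf \<and> left (right acc) \<noteq> Leaf \<and> right (right acc) = Leaf)"

definition sum_test :: "tree \<Rightarrow> tree \<Rightarrow> tree \<Rightarrow> bool" where
  "sum_test c a b \<longleftrightarrow> sum_end (foldl (\<lambda>acc e. sum_step e acc) (Node c b) (telems a))"

lemma ptest_sum:
  assumes "ptime c" "ptime a" "ptime b"
  shows "ptest (\<lambda>x. sum_test (c x) (a x) (b x))"
proof -
  have 1: "ptest sum_end" unfolding sum_end_def by (intro ptime_intros)
  have 2: "ptime (\<lambda>z. sum_step (right (left z)) (right z))" unfolding sum_step_def by (intro ptime_intros)
  have step: "size (sum_step e acc) \<le> size acc" for e acc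
    by (cases acc; cases "right acc") (auto simp: sum_step_def)
  have "size (foldl (\<lambda>acc e. sum_step e acc) acc es) \<le> size acc" for acc es
    by (induction es arbitrary: acc) (auto intro: order_trans[OF _ step])
  moreover have "poly_bounded (\<lambda>x. size (Node (c x) (b x)))"
    using ptime_Node[OF assms(1,3)] by (rule ptimeE) blast
  ultimately have "ptime (\<lambda>x. foldl (\<lambda>acc e. sum_step e acc) (Node (c x) (b x)) (telems (a x)))"
    using 2 by (intro ptime_fold[where B = "\<lambda>x. size (Node (c x) (b x))"] assms ptime_Node)
  from ptest_comp[OF 1 this] show ?thesis unfolding sum_test_def .
qed

definition enc_nat :: "nat \<Rightarrow> tree" where
  "enc_nat n = enc_list (map enc_bool (binary_digits n))"

lemma enc_nat_rec: "enc_nat n = (if n = 0 then Leaf else Node (enc_bool (odd n)) (enc_nat (n div 2)))"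
  unfolding enc_nat_def by (subst binary_digits.simps) simp

lemma enc_nat_eq_Leaf [simp]: "enc_nat n = Leaf \<longleftrightarrow> n = 0"
  by (subst enc_nat_rec) simp

lemma enc_nat_left [simp]: "left (enc_nat n) = enc_bool (odd n)"
  by (subst enc_nat_rec) (simp add: enc_bool_def)

lemma enc_nat_right [simp]: "right (enc_nat n) = enc_nat (n div 2)"
  by (cases "n = 0"; subst enc_nat_rec) (simp_all add: enc_nat_rec[of 0])

lemma foldl_sum_step_Leaf [simp]: "foldl (\<lambda>acc e. sum_step e acc) Leaf es = Leaf"
  by (induction es) (auto simp: sum_step_def)

text \<open>Removing the lowest digit of \<open>m\<close> turns the claim into the same one for
  \<open>m div 2\<close> with the new carry. Numerals have no leading zeros, so running out of
  digits of \<open>n\<close> first means that \<open>n\<close> is too small.\<close>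

lemma sum_test_enc_nat: "sum_test (enc_bool c) (enc_nat m) (enc_nat n) \<longleftrightarrow> n = m + (if c then 1 else 0)"
proof (induction m arbitrary: n c rule: less_induct)
  case (less m)
  show ?case
  proof (cases "m = 0")
    case True
    then show ?thesis
      by (cases c; cases "n = 0"; cases "n = 1")
        (auto simp: sum_test_def sum_end_def enc_nat_rec[of 0] elim!: oddE)
  next
    case False
    have m: "telems (enc_nat m) = enc_bool (odd m) # telems (enc_nat (m div 2))"
      using False by (subst enc_nat_rec) simp
    have IH: "sum_test (enc_bool c) (enc_nat (m div 2)) (enc_nat n) \<longleftrightarrow> n = m div 2 + (if c then 1 else 0)"
      for c n using less False by simp
    show ?thesis
    proof (cases "n \<noteq> 0 \<and> odd n = (odd m \<noteq> c)")
      case True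
      then have "sum_step (enc_bool (odd m)) (Node (enc_bool c) (enc_nat n)) =
          Node (enc_bool (odd m \<and> c)) (enc_nat (n div 2))"
        by (auto simp: sum_step_def enc_bool_def)
      then have "sum_test (enc_bool c) (enc_nat m) (enc_nat n) \<longleftrightarrow>
          n div 2 = m div 2 + (if odd m \<and> c then 1 else 0)"
        using IH by (simp add: sum_test_def m)
      also have "\<dots> \<longleftrightarrow> n = m + (if c then 1 else 0)"
        using True by (cases c; cases "odd m") (auto elim!: evenE oddE)
      finally show ?thesis .
    next
      case neq: False
      then have "sum_step (enc_bool (odd m)) (Node (enc_bool c) (enc_nat n)) = Leaf"
        by (auto simp: sum_step_def)
      then have "\<not> sum_test (enc_bool c) (enc_nat m) (enc_nat n)"
        by (simp add: sum_test_def m sum_end_def)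
      moreover have "n \<noteq> m + (if c then 1 else 0)" using neq False by auto
      ultimately show ?thesis by simp
    qed
  qed
qed

definition int_eq_test :: "tree \<Rightarrow> tree \<Rightarrow> bool" where
  "int_eq_test i j \<longleftrightarrow> (left i = Leaf) = (left j = Leaf) \<and> sum_test Leaf (right i) (right j)"

text \<open>For negative \<open>i\<close> the absolute values decrease, so the roles are exchanged;
  \<open>right j = Leaf\<close> admits the step from -1 to 0, as 0 carries the nonnegative
  sign.\<close>

definition int_succ_test :: "tree \<Rightarrow> tree \<Rightarrow> bool" where
  "int_succ_test i j \<longleftrightarrow>
     (if left i = Leaf then left j = Leaf \<and> sum_test (Node Leaf Leaf) (right i) (right j)
      else (left j \<noteq> Leaf \<or> right j = Leaf) \<and> sum_test (Node Leaf Leaf) (right j) (right i))"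

lemma enc_int_simps [simp]:
  "left (enc_int i) = enc_bool (i < 0)" "right (enc_int i) = enc_nat (nat \<bar>i\<bar>)"
  by (simp_all add: enc_int_def enc_nat_def)

lemma sum_test_eq [simp]: "sum_test Leaf (enc_nat m) (enc_nat n) \<longleftrightarrow> n = m"
  using sum_test_enc_nat[of False] by (simp add: enc_bool_def)

lemma sum_test_Suc [simp]: "sum_test (Node Leaf Leaf) (enc_nat m) (enc_nat n) \<longleftrightarrow> n = Suc m"
  using sum_test_enc_nat[of True] by (simp add: enc_bool_def)

lemma int_eq_test_iff: "int_eq_test (enc_int i) (enc_int j) \<longleftrightarrow> i = j"
  by (auto simp: int_eq_test_def)

lemma int_succ_test_iff: "int_succ_test (enc_int i) (enc_int j) \<longleftrightarrow> j = i + 1"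
  by (auto simp: int_succ_test_def)

definition cell_eq_test :: "tree \<Rightarrow> tree \<Rightarrow> bool" where
  "cell_eq_test c c' \<longleftrightarrow> int_eq_test (left c) (left c') \<and> int_eq_test (right c) (right c')"

definition adjacent_test :: "tree \<Rightarrow> tree \<Rightarrow> bool" where
  "adjacent_test c c' \<longleftrightarrow>
     int_eq_test (left c) (left c') \<and>
       (int_succ_test (right c) (right c') \<or> int_succ_test (right c') (right c)) \<or>
     int_eq_test (right c) (right c') \<and>
       (int_succ_test (left c) (left c') \<or> int_succ_test (left c') (left c))"

lemma cell_eq_test_iff: "cell_eq_test (enc_cell c) (enc_cell c') \<longleftrightarrow> c = c'"
  by (auto simp: cell_eq_test_def enc_cell_def int_eq_test_iff prod_eq_iff)

lemma adjacent_test_iff: "adjacent_test (enc_cell c) (enc_cell c') \<longleftrightarrow> adjacent c c'"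
  by (cases c; cases c') (simp add: adjacent_test_def enc_cell_def int_eq_test_iff int_succ_test_iff adjacent_iff)

lemma ptest_cell_eq: "ptime f \<Longrightarrow> ptime g \<Longrightarrow> ptest (\<lambda>x. cell_eq_test (f x) (g x))"
  unfolding cell_eq_test_def int_eq_test_def by (intro ptime_intros ptest_sum)

lemma ptest_adjacent: "ptime f \<Longrightarrow> ptime g \<Longrightarrow> ptest (\<lambda>x. adjacent_test (f x) (g x))"
  unfolding adjacent_test_def int_eq_test_def int_succ_test_def by (intro ptime_intros ptest_sum)

section \<open>Deciding solvability\<close>

definition switch_test :: "tree \<Rightarrow> bool" where
  "switch_test e \<longleftrightarrow> left (right e) \<noteq> Leaf"

definition open_test :: "tree \<Rightarrow> bool" where
  "open_test e \<longleftrightarrow> left (right e) = Leaf \<and> right (right e) \<noteq> Leaf"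

definition controls_test :: "tree \<Rightarrow> tree \<Rightarrow> bool" where
  "controls_test s e \<longleftrightarrow> switch_test s \<and> cell_eq_test (right (right s)) (left e)"

text \<open>Exclusive or expresses the effect of the first landing, so the changed set of open
  trapdoors is never built as a tree.\<close>

definition land_on_test :: "tree \<Rightarrow> tree \<Rightarrow> bool" where
  "land_on_test q e \<longleftrightarrow> open_test e \<noteq> controls_test q e"

definition explore_test :: "tree \<Rightarrow> tree \<Rightarrow> tree \<Rightarrow> bool" where
  "explore_test q R e \<longleftrightarrow>
     (\<exists>r\<in>set (telems R). cell_eq_test (left r) (left e)) \<or>
     (\<exists>r\<in>set (telems R). adjacent_test (left r) (left e)) \<and>
     (\<not> land_on_test q e \<or> (\<exists>r\<in>set (telems R). controls_test r e))"

text \<open>Filtering the full tile list, rather than extending \<open>R\<close>, keeps every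
  intermediate result no larger than \<open>T\<close>.\<close>

definition explore_step :: "tree \<Rightarrow> tree \<Rightarrow> tree \<Rightarrow> tree" where
  "explore_step q T R = enc_list (rev (filter (explore_test q R) (telems T)))"

definition explore :: "tree \<Rightarrow> tree \<Rightarrow> tree" where
  "explore q T = (explore_step q T ^^ length (telems T)) (Node q Leaf)"

definition level_test :: "tree \<Rightarrow> tree \<Rightarrow> tree \<Rightarrow> bool" where
  "level_test s g T \<longleftrightarrow> cell_eq_test g s \<or>
     (\<exists>q\<in>set (telems T). adjacent_test s (left q) \<and> \<not> open_test q \<and>
        (cell_eq_test g (left q) \<or>
          (\<exists>r\<in>set (telems T). adjacent_test (left q) (left r) \<and> \<not> land_on_test q r) \<and>
          (\<exists>r\<in>set (telems (explore q T)). cell_eq_test g (left r))))"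

lemma ptest_controls: "ptime f \<Longrightarrow> ptime g \<Longrightarrow> ptest (\<lambda>x. controls_test (f x) (g x))"
  unfolding controls_test_def switch_test_def by (intro ptime_intros ptest_cell_eq)

lemma ptest_open: "ptime f \<Longrightarrow> ptest (\<lambda>x. open_test (f x))"
  unfolding open_test_def by (intro ptime_intros)

lemma ptest_land_on: "ptime f \<Longrightarrow> ptime g \<Longrightarrow> ptest (\<lambda>x. land_on_test (f x) (g x))"
  unfolding land_on_test_def by (intro ptime_intros ptest_open ptest_controls)

lemmas game_intros = ptime_intros ptest_cell_eq ptest_adjacent ptest_open ptest_land_on ptest_controls

lemma ptime_explore_step:
  "ptime q \<Longrightarrow> ptime T \<Longrightarrow> ptime R \<Longrightarrow> ptime (\<lambda>x. explore_step (q x) (T x) (R x))"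
  unfolding explore_step_def explore_test_def
  by (intro ptime_filter ptest_ex game_intros; (rule ptime_comp[of q] ptime_comp[of T] ptime_comp[of R], assumption)?;
    intro game_intros)

lemma ptime_explore:
  assumes "ptime q" "ptime T"
  shows "ptime (\<lambda>x. explore (q x) (T x))"
  unfolding explore_def
proof (rule ptime_iterate[where F = "\<lambda>x. explore_step (q x) (T x)"])
  show "ptime (\<lambda>z. explore_step (q (left z)) (T (left z)) (right z))"
    by (intro ptime_explore_step ptime_comp[OF assms(1)] ptime_comp[OF assms(2)] game_intros)
  show "poly_bounded (\<lambda>x. size (Node (q x) (T x)))"
    using ptime_Node[OF assms] by (rule ptimeE) blast
  show "size ((explore_step (q x) (T x) ^^ i) (Node (q x) Leaf)) \<le> size (Node (q x) (T x))" for x i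
  proof (cases i)
    case (Suc j)
    have "size (explore_step (q x) (T x) R) \<le> size (T x)" for R
      unfolding explore_step_def size_enc_list_rev
      using size_enc_list_filter[of _ "telems (T x)"] by simp
    then have "size ((explore_step (q x) (T x) ^^ i) (Node (q x) Leaf)) \<le> size (T x)"
      by (simp add: Suc)
    then show ?thesis by simp
  qed simp
qed (intro assms game_intros)+

lemma ptest_level: "ptest (\<lambda>d. level_test (left d) (left (right d)) (left (right (right d))))"
  unfolding level_test_def by (intro ptest_ex ptime_explore game_intros)

section \<open>The closure computed in rounds\<close>

definition explored_step :: "level \<Rightarrow> cell set \<Rightarrow> cell set \<Rightarrow> cell set" where
  "explored_step L X S = {c \<in> tiles L. c \<in> S \<or>
     (\<exists>r\<in>S. adjacent r c) \<and> (c \<notin> X \<or> (\<exists>r\<in>S. r \<in> switches L \<and> partner L r = c))}"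

text \<open>Until the closure is reached each round adds a tile, so the set after \<open>i\<close>
  rounds has more than \<open>i\<close> elements; this is impossible once \<open>i\<close> is the
  number of tiles.\<close>

lemma explored_iterate:
  assumes "finite (tiles L)" "q \<in> tiles L"
  shows "(explored_step L X ^^ card (tiles L)) {q} = explored L X q"
proof -
  define S where "S i = (explored_step L X ^^ i) {q}" for i
  have S_Suc: "S (Suc i) = explored_step L X (S i)" for i by (simp add: S_def)
  have sub: "S i \<subseteq> explored L X q \<and> S i \<subseteq> tiles L" for i
  proof (induction i)
    case 0
    show ?case using assms(2) by (simp add: S_def explored.base)
  next
    case (Suc i)
    show ?case
    proof (rule conjI; rule subsetI)
      fix c assume c: "c \<in> S (Suc i)"
      then show "c \<in> tiles L" by (simp add: S_Suc explored_step_def)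
      from c consider "c \<in> S i"
        | r where "r \<in> S i" "adjacent r c" "c \<in> tiles L" "c \<notin> X"
        | r s where "r \<in> S i" "adjacent r c" "c \<in> tiles L" "s \<in> S i" "s \<in> switches L" "partner L s = c"
        unfolding S_Suc explored_step_def by blast
      then show "c \<in> explored L X q"
        by cases (use Suc explored.not_open explored.unlocked in blast)+
    qed
  qed
  have inc: "S i \<subseteq> S (Suc i)" for i using sub[of i] by (auto simp: S_Suc explored_step_def)
  have stable: "explored L X q \<subseteq> S i" if "S (Suc i) = S i" for i
  proof
    have "q \<in> S j" for j by (induction j) (use inc in \<open>auto simp: S_def\<close>)
    fix c assume "c \<in> explored L X q"
    then show "c \<in> S i"
    proof (induction rule: explored.induct)
      case base
      show ?case by fact
    next
      case (not_open c c')
      then have "c' \<in> S (Suc i)" unfolding S_Suc explored_step_def by blast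
      then show ?case by (simp add: that)
    next
      case (unlocked c c' s)
      then have "c' \<in> S (Suc i)" unfolding S_Suc explored_step_def by blast
      then show ?case by (simp add: that)
    qed
  qed
  have fin: "finite (S i)" for i using sub[of i] assms(1) finite_subset by blast
  have "explored L X q \<subseteq> S i \<or> i < card (S i)" for i
  proof (induction i)
    case 0
    show ?case by (simp add: S_def)
  next
    case (Suc i)
    show ?case
    proof (cases "explored L X q \<subseteq> S i")
      case True
      then show ?thesis using inc[of i] by blast
    next
      case False
      then have "S i \<subset> S (Suc i)" using inc stable by blast
      then have "card (S i) < card (S (Suc i))" using fin by (intro psubset_card_mono)
      then show ?thesis using Suc False by linarith
    qed
  qed
  moreover have "card (S i) \<le> card (tiles L)" for i using sub assms(1) by (intro card_mono) auto
  ultimately have "explored L X q \<subseteq> S (card (tiles L))" by (metis not_less)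
  then show ?thesis using sub unfolding S_def by blast
qed

section \<open>Correctness of the tests on encoded levels\<close>

context valid_game
begin

lemma left_enc_tile [simp]: "left (enc_tile L c) = enc_cell c"
  by (simp add: enc_tile_def)

lemma switch_test_iff: "c \<in> tiles L \<Longrightarrow> switch_test (enc_tile L c) \<longleftrightarrow> c \<in> switches L"
  by (auto simp: switch_test_def enc_tile_def tiles_def tiles_of_kind_def split: tile_kind.split)

lemma open_test_iff: "c \<in> tiles L \<Longrightarrow> open_test (enc_tile L c) \<longleftrightarrow> c \<in> initially_open L"
  using open_trapdoors
  by (auto simp: open_test_def enc_tile_def tiles_def tiles_of_kind_def split: tile_kind.split)

lemma controls_test_iff:
  "s \<in> tiles L \<Longrightarrow> controls_test (enc_tile L s) (enc_tile L c) \<longleftrightarrow> s \<in> switches L \<and> partner L s = c"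
proof (cases "s \<in> switches L")
  case True
  then have "right (right (enc_tile L s)) = enc_cell (partner L s)"
    by (simp add: enc_tile_def tiles_of_kind_def)
  then show "s \<in> tiles L \<Longrightarrow> ?thesis" by (simp add: controls_test_def switch_test_iff cell_eq_test_iff)
qed (simp add: controls_test_def switch_test_iff)

lemma land_on_test_iff:
  assumes "q \<in> tiles L" "c \<in> tiles L"
  shows "land_on_test (enc_tile L q) (enc_tile L c) \<longleftrightarrow> c \<in> land_on L q (initially_open L)"
  using assms by (auto simp: land_on_test_def open_test_iff controls_test_iff land_on_def)

lemma explore_test_iff:
  assumes "q \<in> tiles L" "c \<in> tiles L" "telems R = map (enc_tile L) rs" "set rs \<subseteq> tiles L"
  shows "explore_test (enc_tile L q) R (enc_tile L c) \<longleftrightarrow>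
    c \<in> explored_step L (land_on L q (initially_open L)) (set rs)"
proof -
  have "(\<exists>r\<in>set rs. controls_test (enc_tile L r) (enc_tile L c)) \<longleftrightarrow>
      (\<exists>r\<in>set rs. r \<in> switches L \<and> partner L r = c)"
    using assms(4) controls_test_iff by blast
  then show ?thesis
    unfolding explore_test_def explored_step_def
    using assms(1,2,3) by (simp add: cell_eq_test_iff adjacent_test_iff land_on_test_iff)
qed

text \<open>The rounds on trees mirror those on sets, starting from the list of \<open>q\<close>
  alone; as \<open>cs\<close> is distinct, the length of the tile list is the number of rounds
  needed.\<close>

lemma set_explore:
  assumes "q \<in> tiles L" "set cs = tiles L" "distinct cs"
  shows "\<exists>rs. telems (explore (enc_tile L q) (enc_list (map (enc_tile L) cs))) = map (enc_tile L) rs \<and>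
    set rs = explored L (land_on L q (initially_open L)) q"
proof -
  let ?X = "land_on L q (initially_open L)"
  let ?T = "enc_list (map (enc_tile L) cs)"
  have "\<exists>rs. telems ((explore_step (enc_tile L q) ?T ^^ i) (Node (enc_tile L q) Leaf)) = map (enc_tile L) rs \<and>
    set rs = (explored_step L ?X ^^ i) {q} \<and> set rs \<subseteq> tiles L" for i
  proof (induction i)
    case 0
    show ?case using assms(1) by (intro exI[of _ "[q]"]) simp
  next
    case (Suc i)
    then obtain rs where rs:
      "telems ((explore_step (enc_tile L q) ?T ^^ i) (Node (enc_tile L q) Leaf)) = map (enc_tile L) rs"
      "set rs = (explored_step L ?X ^^ i) {q}" "set rs \<subseteq> tiles L" by blast
    let ?R = "(explore_step (enc_tile L q) ?T ^^ i) (Node (enc_tile L q) Leaf)"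
    let ?rs = "rev (filter (\<lambda>c. c \<in> explored_step L ?X (set rs)) cs)"
    have "filter (explore_test (enc_tile L q) ?R \<circ> enc_tile L) cs =
        filter (\<lambda>c. c \<in> explored_step L ?X (set rs)) cs"
      by (intro filter_cong refl) (use explore_test_iff[OF assms(1) _ rs(1,3)] assms(2) in simp)
    then have "telems (explore_step (enc_tile L q) ?T ?R) = map (enc_tile L) ?rs"
      by (simp add: explore_step_def filter_map rev_map)
    moreover have "set ?rs = explored_step L ?X (set rs)"
      using assms(2) by (auto simp: explored_step_def)
    moreover have "set ?rs \<subseteq> tiles L" using assms(2) by auto
    ultimately show ?case unfolding rs(2) funpow.simps o_apply by blast
  qed
  from this[of "card (tiles L)"] show ?thesis
    using explored_iterate[OF finite_tiles assms(1)] distinct_card[OF assms(3)] assms(2)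
    unfolding explore_def by auto
qed

lemma level_test_iff:
  assumes "set cs = tiles L" "distinct cs"
  shows "level_test (enc_cell (start L)) (enc_cell (goal L)) (enc_list (map (enc_tile L) cs)) \<longleftrightarrow>
    solvability_test"
proof -
  let ?T = "enc_list (map (enc_tile L) cs)"
  have ex: "(\<exists>r\<in>set (telems (explore (enc_tile L q) ?T)). cell_eq_test (enc_cell (goal L)) (left r)) \<longleftrightarrow>
      goal L \<in> explored L (land_on L q (initially_open L)) q" if q: "q \<in> tiles L" for q
  proof -
    obtain rs where "telems (explore (enc_tile L q) ?T) = map (enc_tile L) rs"
      "set rs = explored L (land_on L q (initially_open L)) q"
      using set_explore[OF q assms] by blast
    then show ?thesis by (auto simp: cell_eq_test_iff)
  qed
  show ?thesis
    unfolding level_test_def solvability_test_def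
    by (simp add: assms(1) cell_eq_test_iff adjacent_test_iff open_test_iff land_on_test_iff ex cong: conj_cong bex_cong)
qed

end

lemma solvable_polynomial_time:
  "decidable_in_polynomial_time encodes_level {L. valid_level L} solvable"
proof -
  let ?test = "\<lambda>d. level_test (left d) (left (right d)) (left (right (right d)))"
  obtain T p where T: "poly_bounded T" and p: "\<And>v. computes v (p v) (\<lambda>d. enc_bool (?test d)) T"
    using ptest_level unfolding ptest_def by (rule ptimeE) blast
  obtain q where q: "\<And>d. T d \<le> poly q (size d)" using T unfolding poly_bounded_def by blast
  have "\<exists>t s. exec (p 0) (input_store d) t s \<and> t \<le> poly q (size d) \<and> (s 0 \<noteq> Leaf \<longleftrightarrow> solvable L)"
    if L: "valid_level L" "encodes_level L d" for L d
  proof -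
    interpret valid_game L by unfold_locales fact
    obtain cs where cs: "distinct cs" "set cs = tiles L"
      and d: "d = enc_list [enc_cell (start L), enc_cell (goal L), enc_list (map (enc_tile L) cs)]"
      using L(2) unfolding encodes_level_def by blast
    obtain t s where 1: "exec (p 0) (input_store d) t s" "s 0 = enc_bool (?test (input_store d 0))"
      "t \<le> T (input_store d 0)"
      by (rule computesE[OF p[of 0], where s = "input_store d"]) blast
    moreover have "input_store d 0 = d" by (simp add: input_store_def)
    moreover have "?test d \<longleftrightarrow> solvable L"
      using level_test_iff[OF cs(2,1)] by (simp add: d solvable_iff)
    ultimately show ?thesis using order_trans[OF 1(3)] q by (intro exI[of _ t] exI[of _ s]) simp
  qed
  then show ?thesis unfolding decidable_in_polynomial_time_def by blast
qed

theorem theorem8: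
  shows "decidable_in_polynomial_time encodes_level {L. valid_level L} solvable
    \<and> (\<exists>C :: real. \<forall>L. valid_level L \<and> solvable L \<longrightarrow>
         (\<exists>ds. solution L ds \<and> real (length ds) \<le> C * real (num_tiles L) ^ 2))
    \<and> (\<exists>c :: real. c > 0 \<and> (\<exists>N. \<forall>n \<ge> N. \<exists>L. valid_level L \<and> num_tiles L = n \<and> solvable L \<and>
         (\<forall>ds. solution L ds \<longrightarrow> real (length ds) \<ge> c * real n ^ 2)))"
proof (intro conjI)
  show "decidable_in_polynomial_time encodes_level {L. valid_level L} solvable"
    by (rule solvable_polynomial_time)
  have "\<exists>ds. solution L ds \<and> real (length ds) \<le> 50 * real (num_tiles L) ^ 2"
    if "valid_level L" "solvable L" for L
  proof -
    interpret valid_game L by unfold_locales fact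
    obtain ds where ds: "solution L ds" "length ds \<le> 50 * num_tiles L ^ 2"
      using test_imp_short_solution solvable_imp_test \<open>solvable L\<close> by blast
    from ds(2) have "real (length ds) \<le> real (50 * num_tiles L ^ 2)" by (simp only: of_nat_le_iff)
    with ds(1) show ?thesis by auto
  qed
  then show "\<exists>C :: real. \<forall>L. valid_level L \<and> solvable L \<longrightarrow>
      (\<exists>ds. solution L ds \<and> real (length ds) \<le> C * real (num_tiles L) ^ 2)"
    by blast
  show "\<exists>c :: real. c > 0 \<and> (\<exists>N. \<forall>n \<ge> N. \<exists>L. valid_level L \<and> num_tiles L = n \<and> solvable L \<and>
      (\<forall>ds. solution L ds \<longrightarrow> real (length ds) \<ge> c * real n ^ 2))"
    by (intro exI[of _ "1 / 20 :: real"] exI[of _ 20] conjI allI impI quadratic_lower_bound) auto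
qed

end
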